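(* Let $\theta\in(-1,0)$, $r>1$, put $\alpha=-1/\theta$, so that $\alpha>1$, and let $\{Z_n\}_{n\ge0}$ be a (possibly defective) GW$^{\,\theta}$-process with parameters $(\theta,r,a_n,c_n)_{n\ge1}$. Then $$q=r-(Ar^{1/\alpha}+C)^{\alpha},\quad q_\Delta=1-r+(A(r-1)^{1/\alpha}+C)^{\alpha},$$ where $A=\lim_{n\to\infty}A_n\in[0,1)$ and $C=\lim_{n\to\infty}C_n$ satisfies $(1-A)(r-1)^{1/\alpha}\le C\le(1-A)r^{1/\alpha}$. (i) If $A=0$, then $q=1-q_\Delta=r-C^{\alpha}\in[0,1]$, so that $Q=1$. Furthermore, $$A_n^{-1}\mathrm{P}(\tau>n)\to\alpha C^{\alpha-1}(r^{1/\alpha}-(r-1)^{1/\alpha}),$$ $$\mathrm{E}(Z_n|\tau>n)\to\frac{(r-1)^{1/\alpha-1}}{r^{1/\alpha}-(r-1)^{1/\alpha}},\qquad \mathrm{E}(s^{Z_n}|\tau>n)\to\frac{r^{1/\alpha}-(r-s)^{1/\alpha}}{r^{1/\alpha}-(r-1)^{1/\alpha}},\quad 0\le s\le1.$$ (ii) If $A\in(0,1)$, then $Q\in[0,1)$, $$\mathrm{E}(Z_n;\tau_\Delta>n)\to A(A+C(r-1)^{-1/\alpha})^{\alpha-1},$$ and $Z_n$ converges almost surely to a random variable $Z_\infty$ taking values in the set $\{\Delta,0,1,2,\ldots\}$, with $$\mathrm{P}(Z_\infty=\Delta)=1-r+(A(r-1)^{1/\alpha}+C)^{\alpha},$$ $$\mathrm{E}(s^{Z_\infty};Z_\infty\ne\Delta)=r-(A(r-s)^{1/\alpha}+C)^{\alpha},\quad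 0\le s\le1.$$
   Context: All limits are as $n\to\infty$. Let $\theta\in(-1,0)$, $r>1$, and let $(a_n,c_n)_{n\ge1}$ be real sequences with $0<a_n<1$ and $(1-a_n)(r-1)^{-\theta}\le c_n\le(1-a_n)r^{-\theta}$ for all $n\ge1$. Put $$f_n(s)=r-(a_n(r-s)^{-\theta}+c_n)^{-1/\theta},\quad 0\le s\le1.$$ Each $f_n(s)=\sum_{j\ge0}p_n(j)s^j$ is a possibly defective probability generating function: $p_n(j)\ge0$ and $f_n(1)\le1$. The GW$^{\,\theta}$-process with parameters $(\theta,r,a_n,c_n)_{n\ge1}$ is the Galton-Watson process in a varying environment with $Z_0=1$, in which each individual of generation $n-1$, independently of everything else, has $j$ offspring with probability $p_n(j)$, $j\ge0$, and with the remaining probability $1-f_n(1)$ sends the entire process to an additional absorbing state $\Delta$ at time $n$ (so $Z_n=\Delta$ if some individual of generation $n-1$ does so, or if $Z_{n-1}=\Delta$; otherwise $Z_n$ is the total number of offspring). The state $0$ is also absorbing. With $F_n=f_1\circ\cdots\circ f_n$, one has $\mathrm{E}(s^{Z_n};Z_n\ne\Delta)=F_n(s)$, $\mathrm{P}(Z_n=0)=F_n(0)$, $\mathrm{P}(Z_n=\Delta)=1-F_n(1)$. Notation: $\mathrm{E}(X;E)$ is the expectation of $X$ times the indicator of the event $E$. $\tau_0$ and $\tau_\Delta$ are the absorption times at $0$ and at $\Delta$ respectively, $\tau=\min(\tau_0,\tau_\Delta)$, $q=\mathrm{P}(\tau_0<\infty)$, $q_\Delta=\mathrm{P}(\tau_\Delta<\infty)$,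 $Q=\mathrm{P}(\tau<\infty)=q+q_\Delta$. $A_0=1$, $A_n=\prod_{i=1}^na_i$, $C_n=\sum_{i=1}^nA_{i-1}c_i$.
   Formalization: In (i) the limit of E(Z_n|τ>n) is corrected to (r-1)^{1/α-1}/(α(r^{1/α}-(r-1)^{1/α})): the printed formula lacks the factor α in the denominator and is false, e.g. for θ=-1/2, r=2, a_n=c_n=1/2. *)

theory Defs
  imports "HOL-Probability.Probability"
begin

definition gw_gen :: "real \<Rightarrow> real \<Rightarrow> real \<Rightarrow> real \<Rightarrow> real \<Rightarrow> real" where
  "gw_gen \<theta> r a c s = r - (a * (r - s) powr (- \<theta>) + c) powr (- 1 / \<theta>)"

definition gw_A :: "(nat \<Rightarrow> real) \<Rightarrow> nat \<Rightarrow> real" where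
  "gw_A a n = (\<Prod>i=1..n. a i)"

definition gw_C :: "(nat \<Rightarrow> real) \<Rightarrow> (nat \<Rightarrow> real) \<Rightarrow> nat \<Rightarrow> real" where
  "gw_C a c n = (\<Sum>i=1..n. gw_A a (i - 1) * c i)"

text \<open>The state space \<open>{\<Delta>, 0, 1, 2, \<dots>}\<close> is \<^typ>\<open>nat option\<close>, with \<^term>\<open>None\<close> in the role of
  the additional absorbing state \<open>\<Delta>\<close>.\<close>

abbreviation cemetery :: "nat option" where
  "cemetery \<equiv> None"

text \<open>For \<open>n \<ge> 1\<close>, \<open>\<xi> n k\<close> is what the individual number \<open>k\<close> of generation \<open>n - 1\<close> does: it has \<open>j\<close>
  offspring (\<open>Some j\<close>), or it sends the whole process to \<open>\<Delta>\<close> at time \<open>n\<close>. The condition \<open>pgf\<close>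
  says that the \<open>p n j\<close> are the power series coefficients of \<open>f\<^sub>n\<close>, which determines them; at \<open>s = 1\<close>
  it gives \<open>\<Sum>j. p n j = f\<^sub>n(1)\<close>, so that \<open>\<xi> n k = \<Delta>\<close> has the remaining probability \<open>1 - f\<^sub>n(1)\<close>.\<close>

locale gw_theta_process = prob_space M
  for M :: "'w measure" +
  fixes \<theta> r :: real
    and a c :: "nat \<Rightarrow> real"
    and p :: "nat \<Rightarrow> nat \<Rightarrow> real"
    and \<xi> :: "nat \<Rightarrow> nat \<Rightarrow> 'w \<Rightarrow> nat option"
    and Z :: "nat \<Rightarrow> 'w \<Rightarrow> nat option"
  assumes pgf: "\<And>n s. n \<ge> 1 \<Longrightarrow> 0 \<le> s \<Longrightarrow> s \<le> 1 \<Longrightarrow>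
                  (\<lambda>j. p n j * s ^ j) sums gw_gen \<theta> r (a n) (c n) s"
    and indep: "indep_vars (\<lambda>_. count_space UNIV) (\<lambda>(n, k). \<xi> n k) ({1..} \<times> UNIV)"
    and offspring: "\<And>n k j. n \<ge> 1 \<Longrightarrow> prob {\<omega> \<in> space M. \<xi> n k \<omega> = Some j} = p n j"
    and Z_0: "\<And>\<omega>. \<omega> \<in> space M \<Longrightarrow> Z 0 \<omega> = Some 1"
    and Z_Suc: "\<And>n \<omega>. \<omega> \<in> space M \<Longrightarrow> Z (Suc n) \<omega> =
      (case Z n \<omega> of
         None \<Rightarrow> cemetery
       | Some m \<Rightarrow> if \<exists>k<m. \<xi> (Suc n) k \<omega> = cemetery then cemetery
                   else Some (\<Sum>k<m. the (\<xi> (Suc n) k \<omega>)))"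

definition hit_time :: "(nat \<Rightarrow> 'w \<Rightarrow> 'b) \<Rightarrow> 'b \<Rightarrow> 'w \<Rightarrow> enat" where
  "hit_time Z x \<omega> = (INF n \<in> {n. Z n \<omega> = x}. enat n)"

definition tau_0 :: "(nat \<Rightarrow> 'w \<Rightarrow> nat option) \<Rightarrow> 'w \<Rightarrow> enat" where
  "tau_0 Z = hit_time Z (Some 0)"

definition tau_D :: "(nat \<Rightarrow> 'w \<Rightarrow> nat option) \<Rightarrow> 'w \<Rightarrow> enat" where
  "tau_D Z = hit_time Z cemetery"

definition tau :: "(nat \<Rightarrow> 'w \<Rightarrow> nat option) \<Rightarrow> 'w \<Rightarrow> enat" where
  "tau Z \<omega> = min (tau_0 Z \<omega>) (tau_D Z \<omega>)"

text \<open>The probability that an absorption time is finite.\<close>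

definition absorption_prob :: "'w measure \<Rightarrow> ('w \<Rightarrow> enat) \<Rightarrow> real" where
  "absorption_prob M T = measure M {\<omega> \<in> space M. T \<omega> < \<infinity>}"

text \<open>\<open>E(X; E)\<close> is the set integral \<open>LINT \<omega>:E|M. X \<omega>\<close>; \<open>E(X | E)\<close> is the elementary conditional
  expectation given an event.\<close>

definition cond_expect :: "'w measure \<Rightarrow> ('w \<Rightarrow> real) \<Rightarrow> 'w set \<Rightarrow> real" where
  "cond_expect M X E = (LINT \<omega>:E|M. X \<omega>) / measure M E"

end

theory Submission
  imports Defs
begin

text \<open>The functions \<open>f\<^sub>n\<close> are conjugate to affine maps: \<open>(r - f\<^sub>n(s))\<^sup>1\<^sup>/\<^sup>\<alpha> = a\<^sub>n (r - s)\<^sup>1\<^sup>/\<^sup>\<alpha> + c\<^sub>n\<close>. Hence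
  \<open>F\<^sub>n(s) = r - (A\<^sub>n (r - s)\<^sup>1\<^sup>/\<^sup>\<alpha> + C\<^sub>n)\<^sup>\<alpha>\<close>, and all distributional claims are limits of this
  expression, of its differences divided by \<open>A\<^sub>n\<close>, and of its derivative at \<open>1\<close>. Almost sure
  convergence for \<open>A > 0\<close> follows from the Borel--Cantelli lemma: an individual of generation \<open>n\<close>
  has exactly one child with probability at least \<open>a\<^sub>n\<^sub>+\<^sub>1\<^sup>\<alpha>\<close>, so \<open>P(Z\<^sub>n\<^sub>+\<^sub>1 \<noteq> Z\<^sub>n)\<close> is at most a
  constant times \<open>1 - a\<^sub>n\<^sub>+\<^sub>1\<close>, which is summable.\<close>

section \<open>The population size as a function of the offspring table\<close>

fun gw_state :: "nat \<Rightarrow> (nat \<times> nat \<Rightarrow> nat option) \<Rightarrow> nat option" where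
  "gw_state 0 x = Some 1"
| "gw_state (Suc n) x = (case gw_state n x of
     None \<Rightarrow> None
   | Some m \<Rightarrow> if \<exists>k<m. x (Suc n, k) = None then None else Some (\<Sum>k<m. the (x (Suc n, k))))"

text \<open>The state at time \<open>n\<close> reads only the rows \<open>1..n\<close> of the table.
  This locality is what later makes \<open>Z n\<close> a function of a block of variables disjoint
  from row \<open>n + 1\<close>, hence independent of that row.\<close>

lemma gw_state_cong:
  assumes "\<And>i. i \<in> {1..n} \<times> UNIV \<Longrightarrow> x i = y i"
  shows "gw_state n x = gw_state n y"
  using assms
proof (induction n)
  case (Suc n)
  have "gw_state n x = gw_state n y" by (rule Suc.IH) (use Suc.prems in auto)
  moreover have "x (Suc n, k) = y (Suc n, k)" for k using Suc.prems by auto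
  ultimately show ?case by (simp only: gw_state.simps)
qed simp

lemma measurable_gw_state:
  assumes "{1..n} \<times> UNIV \<subseteq> I"
  shows "gw_state n \<in> measurable (PiM I (\<lambda>_. count_space UNIV)) (count_space UNIV)"
  using assms
proof (induction n)
  case (Suc n)
  let ?N = "PiM I (\<lambda>_. count_space UNIV) :: (nat \<times> nat \<Rightarrow> nat option) measure"
  have IH[measurable]: "gw_state n \<in> measurable ?N (count_space UNIV)"
    by (rule Suc.IH) (use Suc.prems in auto)
  have [measurable]: "(\<lambda>x. x (Suc n, k)) \<in> measurable ?N (count_space UNIV)" for k
    by (rule measurable_component_singleton) (use Suc.prems in auto)
  have [measurable]: "(\<lambda>x. the (x (Suc n, k))) \<in> measurable ?N (count_space UNIV)" for k
    by (rule measurable_compose[where N = "count_space UNIV"]) simp_all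
  have [measurable]: "(\<lambda>x. \<Sum>k<m. the (x (Suc n, k))) \<in> measurable ?N (count_space UNIV)" for m
  proof (induction m)
    case (Suc m)
    have "(\<lambda>x. (\<Sum>k<m. the (x (Suc n, k))) + the (x (Suc n, m))) \<in> measurable ?N (count_space UNIV)"
      using Suc by measurable
    then show ?case by simp
  qed simp
  \<comment> \<open>The previous state determines how many entries of the new row enter the sum.
    Freezing it at one of its countably many values \<open>z\<close> leaves a sum of fixed length,
    and \<open>measurable_compose_countable\<close> puts the pieces together.\<close>
  have "(\<lambda>x. case z of None \<Rightarrow> None | Some m \<Rightarrow> if \<exists>k<m. x (Suc n, k) = None then None
      else Some (\<Sum>k<m. the (x (Suc n, k)))) \<in> measurable ?N (count_space UNIV)" for z
  proof (cases z)
    case (Some m)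
    have "(\<lambda>x. Some (\<Sum>k<m. the (x (Suc n, k)))) \<in> measurable ?N (count_space UNIV)"
      by (rule measurable_compose[where N = "count_space UNIV"]) simp_all
    then have "(\<lambda>x. if \<exists>k<m. x (Suc n, k) = None then None
        else Some (\<Sum>k<m. the (x (Suc n, k)))) \<in> measurable ?N (count_space UNIV)"
      by measurable
    then show ?thesis by (simp add: Some)
  qed simp
  from measurable_compose_countable[OF this IH] show ?case
    by simp
next
  case 0
  have "gw_state 0 = (\<lambda>x. Some 1)" by (rule ext) simp
  then show ?case by simp
qed

text \<open>The hypothesis expresses that \<open>x\<close> is absorbing along the path: a visit up
  to time \<open>n\<close> is still visible at time \<open>n\<close>, so the present state alone
  decides whether the hitting time has passed.\<close>

lemma enat_less_hit_time_iff:
  assumes "\<And>m. m \<le> n \<Longrightarrow> Z m \<omega> = x \<Longrightarrow> Z n \<omega> = x"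
  shows "enat n < hit_time Z x \<omega> \<longleftrightarrow> Z n \<omega> \<noteq> x"
proof -
  have "hit_time Z x \<omega> \<le> enat n \<longleftrightarrow> Z n \<omega> = x"
  proof
    assume "hit_time Z x \<omega> \<le> enat n"
    \<comment> \<open>An infimum lies strictly below a bound iff some member does, so the weak
      inequality is first turned into a strict one.\<close>
    then have "hit_time Z x \<omega> < enat (Suc n)"
      by (metis enat_ord_simps(2) le_less_trans lessI)
    then obtain m where "m < Suc n" "Z m \<omega> = x"
      by (auto simp: hit_time_def INF_less_iff)
    then show "Z n \<omega> = x" using assms[of m] by simp
  next
    assume "Z n \<omega> = x"
    then show "hit_time Z x \<omega> \<le> enat n"
      unfolding hit_time_def by (intro INF_lower) simp
  qed
  then show ?thesis by (simp add: not_le[symmetric])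
qed

text \<open>The power \<open>s ^ Z\<close> with the convention that the cemetery has weight 0, so
  that its expectation is E(s^Z; Z \<noteq> \<Delta>). The value type stays generic because both
  \<open>ennreal\<close> and \<open>real\<close> weights occur.\<close>

fun gw_weight :: "'a :: comm_semiring_1 \<Rightarrow> nat option \<Rightarrow> 'a" where
  "gw_weight s None = 0"
| "gw_weight s (Some j) = s ^ j"

section \<open>Independence of generations, the branching recursion and absorption times\<close>

context gw_theta_process
begin

lemma measurable_xi: "n \<ge> 1 \<Longrightarrow> \<xi> n k \<in> measurable M (count_space UNIV)"
  using indep unfolding indep_vars_def by auto

lemma Z_eq_gw_state:
  assumes "\<omega> \<in> space M"
  shows "Z n \<omega> = gw_state n (\<lambda>(m, k). \<xi> m k \<omega>)"
proof (induction n)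
  case (Suc n)
  then show ?case by (simp only: gw_state.simps Z_Suc[OF assms] prod.case)
qed (simp add: Z_0 assms)

lemma Z_eq_gw_state_restrict:
  assumes "\<omega> \<in> space M"
  shows "Z n \<omega> = gw_state n (restrict (\<lambda>i. (\<lambda>(m, k). \<xi> m k) i \<omega>) ({1..n} \<times> UNIV))"
  unfolding Z_eq_gw_state[OF assms] by (rule gw_state_cong) auto

lemma measurable_Z [measurable]: "Z n \<in> measurable M (count_space UNIV)"
proof -
  have "(\<lambda>\<omega>. restrict (\<lambda>i. (\<lambda>(m, k). \<xi> m k) i \<omega>) ({1..n} \<times> UNIV)) \<in>
      measurable M (PiM ({1..n} \<times> UNIV) (\<lambda>_. count_space UNIV))"
    by (rule measurable_restrict) (auto intro: measurable_xi)
  from measurable_compose[OF this measurable_gw_state[OF subset_refl]]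
  show ?thesis
    by (subst measurable_cong[OF Z_eq_gw_state_restrict])
qed

text \<open>On the event that the population at time \<open>n\<close> equals the fixed number
  \<open>m\<close>, only finitely many individuals of the next generation matter. These are
  independent of each other and of the past, so the expectation factorizes.\<close>

lemma nn_integral_generation:
  fixes h :: "nat option \<Rightarrow> ennreal"
  shows "(\<integral>\<^sup>+\<omega>. indicator {Some m} (Z n \<omega>) * (\<Prod>k<m. h (\<xi> (Suc n) k \<omega>)) \<partial>M) =
    emeasure M {\<omega> \<in> space M. Z n \<omega> = Some m} * (\<Prod>k<m. \<integral>\<^sup>+\<omega>. h (\<xi> (Suc n) k \<omega>) \<partial>M)"
proof -
  let ?X = "\<lambda>i. (\<lambda>(m, k). \<xi> m k) i"
  \<comment> \<open>Disjoint index blocks labelled by an option: \<open>None\<close> stands for the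
    whole past, \<open>Some k\<close> for individual \<open>k\<close> of the new generation.
    Functions of disjoint blocks of an independent family are again independent.\<close>
  let ?K = "\<lambda>j :: nat option. case j of None \<Rightarrow> {1..n} \<times> UNIV | Some k \<Rightarrow> {(Suc n, k)}"
  let ?N = "\<lambda>I. PiM I (\<lambda>_. count_space UNIV) :: (nat \<times> nat \<Rightarrow> nat option) measure"
  let ?Y = "\<lambda>j x. case j of None \<Rightarrow> indicator {Some m} (gw_state n x)
     | Some k \<Rightarrow> h (x (Suc n, k))"
  let ?J = "insert None (Some ` {..<m})"
  have "indep_vars (\<lambda>j. ?N (?K j)) (\<lambda>j \<omega>. restrict (\<lambda>i. ?X i \<omega>) (?K j)) ?J"
    by (rule indep_vars_restrict[OF indep]) (auto simp: disjoint_family_on_def)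
  then have *: "indep_vars (\<lambda>_. borel)
      (\<lambda>j \<omega>. ?Y j (restrict (\<lambda>i. ?X i \<omega>) (?K j))) ?J"
  proof (rule indep_vars_compose2)
    fix j assume j: "j \<in> ?J"
    show "?Y j \<in> borel_measurable (?N (?K j))"
    proof (cases j)
      case None
      then show ?thesis
        using measurable_compose[OF measurable_gw_state[of n "{1..n} \<times> UNIV", OF subset_refl],
          of "indicator {Some m}" "borel :: ennreal measure"] by simp
    next
      case (Some k)
      then show ?thesis
        using measurable_compose[OF measurable_component_singleton[of "(Suc n, k)" "{(Suc n, k)}"
            "\<lambda>_. count_space UNIV"], of h borel] by simp
    qed
  qed
  have "(\<integral>\<^sup>+\<omega>. indicator {Some m} (Z n \<omega>) * (\<Prod>k<m. h (\<xi> (Suc n) k \<omega>)) \<partial>M) =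
      (\<integral>\<^sup>+\<omega>. (\<Prod>j\<in>?J. ?Y j (restrict (\<lambda>i. ?X i \<omega>) (?K j))) \<partial>M)"
    by (rule nn_integral_cong) (simp add: Z_eq_gw_state_restrict prod.reindex)
  also have "\<dots> = (\<Prod>j\<in>?J. \<integral>\<^sup>+\<omega>. ?Y j (restrict (\<lambda>i. ?X i \<omega>) (?K j)) \<partial>M)"
    by (rule indep_vars_nn_integral[OF _ *]) auto
  also have "\<dots> = (\<integral>\<^sup>+\<omega>. indicator {Some m} (Z n \<omega>) \<partial>M) * (\<Prod>k<m. \<integral>\<^sup>+\<omega>. h (\<xi> (Suc n) k \<omega>) \<partial>M)"
    by (simp add: prod.reindex Z_eq_gw_state_restrict cong: nn_integral_cong)
  also have "(\<integral>\<^sup>+\<omega>. indicator {Some m} (Z n \<omega>) \<partial>M) =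
      (\<integral>\<^sup>+\<omega>. indicator {\<omega> \<in> space M. Z n \<omega> = Some m} \<omega> \<partial>M)"
    by (rule nn_integral_cong) (simp add: indicator_def)
  finally show ?thesis by simp
qed

lemma suminf_indicator_Some:
  "(\<Sum>m. indicator {Some m} z * g m :: ennreal) = (case z of None \<Rightarrow> 0 | Some m \<Rightarrow> g m)"
proof (cases z)
  case (Some k)
  have "(\<Sum>m. indicator {Some m} z * g m) = (\<Sum>m\<in>{k}. indicator {Some m} z * g m)"
    by (rule suminf_finite) (auto simp: Some)
  then show ?thesis by (simp add: Some)
qed simp

text \<open>Two functionals matter: \<open>h = gw_weight s\<close> yields the recursion for the generating functions,
  the indicator of having exactly one child yields a bound on the probability that \<open>Z\<close> changes.\<close>

lemma nn_integral_branching: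
  assumes h: "\<And>k. (\<integral>\<^sup>+\<omega>. h (\<xi> (Suc n) k \<omega>) \<partial>M) = u"
  shows "(\<integral>\<^sup>+\<omega>. (case Z n \<omega> of None \<Rightarrow> 0 | Some m \<Rightarrow> \<Prod>k<m. h (\<xi> (Suc n) k \<omega>)) \<partial>M) =
    (\<integral>\<^sup>+\<omega>. gw_weight u (Z n \<omega>) \<partial>M)"
proof -
  have [measurable]: "\<xi> (Suc n) k \<in> measurable M (count_space UNIV)" for k
    by (rule measurable_xi) simp
  have "(\<integral>\<^sup>+\<omega>. (case Z n \<omega> of None \<Rightarrow> 0 | Some m \<Rightarrow> \<Prod>k<m. h (\<xi> (Suc n) k \<omega>)) \<partial>M) =
      (\<integral>\<^sup>+\<omega>. (\<Sum>m. indicator {Some m} (Z n \<omega>) * (\<Prod>k<m. h (\<xi> (Suc n) k \<omega>))) \<partial>M)"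
    by (simp add: suminf_indicator_Some)
  also have "\<dots> = (\<Sum>m. \<integral>\<^sup>+\<omega>. indicator {Some m} (Z n \<omega>) * (\<Prod>k<m. h (\<xi> (Suc n) k \<omega>)) \<partial>M)"
    by (rule nn_integral_suminf) measurable
  also have "\<dots> = (\<Sum>m. emeasure M {\<omega> \<in> space M. Z n \<omega> = Some m} * u ^ m)"
    by (simp add: nn_integral_generation h)
  also have "\<dots> = (\<Sum>m. \<integral>\<^sup>+\<omega>. indicator {Some m} (Z n \<omega>) * u ^ m \<partial>M)"
  proof (rule suminf_cong)
    fix m
    have "(\<integral>\<^sup>+\<omega>. indicator {Some m} (Z n \<omega>) * u ^ m \<partial>M) =
        (\<integral>\<^sup>+\<omega>. u ^ m * indicator {\<omega> \<in> space M. Z n \<omega> = Some m} \<omega> \<partial>M)"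
      by (rule nn_integral_cong) (simp add: indicator_def)
    then show "emeasure M {\<omega> \<in> space M. Z n \<omega> = Some m} * u ^ m =
        (\<integral>\<^sup>+\<omega>. indicator {Some m} (Z n \<omega>) * u ^ m \<partial>M)"
      by (simp add: nn_integral_cmult_indicator mult.commute)
  qed
  also have "\<dots> = (\<integral>\<^sup>+\<omega>. (\<Sum>m. indicator {Some m} (Z n \<omega>) * u ^ m) \<partial>M)"
    by (rule nn_integral_suminf[symmetric]) measurable
  also have "\<dots> = (\<integral>\<^sup>+\<omega>. gw_weight u (Z n \<omega>) \<partial>M)"
    by (intro nn_integral_cong) (simp add: suminf_indicator_Some split: option.split)
  finally show ?thesis .
qed

text \<open>A single individual going to the cemetery kills the product, just as it sends the
  process to \<Delta>; otherwise the power of a sum is the product of the powers.\<close>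

lemma gw_weight_Z_Suc:
  assumes "\<omega> \<in> space M"
  shows "gw_weight s (Z (Suc n) \<omega>) =
    (case Z n \<omega> of None \<Rightarrow> 0 | Some m \<Rightarrow> \<Prod>k<m. gw_weight s (\<xi> (Suc n) k \<omega>))"
proof (cases "Z n \<omega>")
  case (Some m)
  show ?thesis
  proof (cases "\<exists>k<m. \<xi> (Suc n) k \<omega> = None")
    case True
    then obtain k where "k < m" "gw_weight s (\<xi> (Suc n) k \<omega>) = 0" by auto
    then have "(\<Prod>k<m. gw_weight s (\<xi> (Suc n) k \<omega>)) = 0" by (intro prod_zero) auto
    then show ?thesis using True by (simp add: Z_Suc[OF assms] Some)
  next
    case False
    then have "\<xi> (Suc n) k \<omega> = Some (the (\<xi> (Suc n) k \<omega>))" if "k < m" for k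
      using that by auto
    then have "(\<Prod>k<m. gw_weight s (\<xi> (Suc n) k \<omega>)) = (\<Prod>k<m. s ^ the (\<xi> (Suc n) k \<omega>))"
      by (intro prod.cong) (auto, metis gw_weight.simps(2))
    moreover have "Z (Suc n) \<omega> = Some (\<Sum>k<m. the (\<xi> (Suc n) k \<omega>))"
      by (simp only: Z_Suc[OF assms] Some option.case False if_False)
    ultimately show ?thesis by (simp add: Some power_sum)
  qed
qed (simp add: Z_Suc[OF assms])

lemma p_nonneg: "n \<ge> 1 \<Longrightarrow> p n j \<ge> 0"
  using offspring[of n 0 j] by (metis measure_nonneg)

lemma nn_integral_gw_weight_xi:
  assumes "n \<ge> 1" "0 \<le> s" "s \<le> 1"
  shows "(\<integral>\<^sup>+\<omega>. gw_weight (ennreal s) (\<xi> n k \<omega>) \<partial>M) = ennreal (gw_gen \<theta> r (a n) (c n) s)"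
proof -
  have [measurable]: "\<xi> n k \<in> measurable M (count_space UNIV)"
    by (rule measurable_xi) fact
  have "(\<integral>\<^sup>+\<omega>. gw_weight (ennreal s) (\<xi> n k \<omega>) \<partial>M) =
      (\<integral>\<^sup>+\<omega>. (\<Sum>j. indicator {Some j} (\<xi> n k \<omega>) * ennreal s ^ j) \<partial>M)"
    by (intro nn_integral_cong) (simp add: suminf_indicator_Some split: option.split)
  also have "\<dots> = (\<Sum>j. \<integral>\<^sup>+\<omega>. indicator {Some j} (\<xi> n k \<omega>) * ennreal s ^ j \<partial>M)"
    by (rule nn_integral_suminf) measurable
  also have "\<dots> = (\<Sum>j. ennreal (p n j * s ^ j))"
  proof (rule suminf_cong)
    fix j
    have "(\<integral>\<^sup>+\<omega>. indicator {Some j} (\<xi> n k \<omega>) * ennreal s ^ j \<partial>M) =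
        (\<integral>\<^sup>+\<omega>. ennreal s ^ j * indicator {\<omega> \<in> space M. \<xi> n k \<omega> = Some j} \<omega> \<partial>M)"
      by (rule nn_integral_cong) (simp add: indicator_def)
    then show "(\<integral>\<^sup>+\<omega>. indicator {Some j} (\<xi> n k \<omega>) * ennreal s ^ j \<partial>M) = ennreal (p n j * s ^ j)"
      using assms by (simp add: nn_integral_cmult_indicator emeasure_eq_measure offspring
        ennreal_power ennreal_mult'[symmetric] mult.commute p_nonneg)
  qed
  also have "\<dots> = ennreal (\<Sum>j. p n j * s ^ j)"
    using pgf[OF assms] assms by (intro suminf_ennreal2) (auto simp: p_nonneg sums_iff)
  also have "(\<Sum>j. p n j * s ^ j) = gw_gen \<theta> r (a n) (c n) s"
    using pgf[OF assms] by (simp add: sums_iff)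
  finally show ?thesis .
qed

lemma Z_absorbed:
  assumes "\<omega> \<in> space M" "x = None \<or> x = Some 0" "m \<le> n" "Z m \<omega> = x"
  shows "Z n \<omega> = x"
  using \<open>m \<le> n\<close>
proof (induction n rule: dec_induct)
  case (step n)
  then show ?case using assms(2) by (auto simp: Z_Suc[OF assms(1)])
qed fact

lemma tau_0_gt_iff: "\<omega> \<in> space M \<Longrightarrow> enat n < tau_0 Z \<omega> \<longleftrightarrow> Z n \<omega> \<noteq> Some 0"
  unfolding tau_0_def by (rule enat_less_hit_time_iff) (auto intro: Z_absorbed)

lemma tau_D_gt_iff: "\<omega> \<in> space M \<Longrightarrow> enat n < tau_D Z \<omega> \<longleftrightarrow> Z n \<omega> \<noteq> None"
  unfolding tau_D_def by (rule enat_less_hit_time_iff) (auto intro: Z_absorbed)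

lemma tau_gt_iff: "\<omega> \<in> space M \<Longrightarrow> enat n < tau Z \<omega> \<longleftrightarrow> Z n \<omega> \<noteq> Some 0 \<and> Z n \<omega> \<noteq> None"
  by (simp add: tau_def tau_0_gt_iff tau_D_gt_iff)

text \<open>The events that \<open>Z n\<close> lies in \<open>S\<close> increase with
  \<open>n\<close>, because \<open>enat (Suc n) < T\<close> implies \<open>enat n < T\<close>.
  Continuity from below gives the limit. Taking for \<open>S\<close> one absorbing state or both
  covers \<open>tau_0\<close>, \<open>tau_D\<close> and \<open>tau\<close>.\<close>

lemma absorption_prob_LIMSEQ:
  assumes T: "\<And>\<omega> n. \<omega> \<in> space M \<Longrightarrow> enat n < T \<omega> \<longleftrightarrow> Z n \<omega> \<notin> S"
  shows "(\<lambda>n. prob {\<omega> \<in> space M. Z n \<omega> \<in> S}) \<longlonglongrightarrow> absorption_prob M T"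
proof -
  have "(\<lambda>n. prob {\<omega> \<in> space M. Z n \<omega> \<in> S}) \<longlonglongrightarrow> prob (\<Union>n. {\<omega> \<in> space M. Z n \<omega> \<in> S})"
  proof (rule finite_Lim_measure_incseq)
    show "range (\<lambda>n. {\<omega> \<in> space M. Z n \<omega> \<in> S}) \<subseteq> events" by auto
    show "incseq (\<lambda>n. {\<omega> \<in> space M. Z n \<omega> \<in> S})"
    proof (rule incseq_SucI, safe)
      fix n \<omega> assume "\<omega> \<in> space M" "Z n \<omega> \<in> S"
      then show "Z (Suc n) \<omega> \<in> S"
        using T[of \<omega> n] T[of \<omega> "Suc n"] by (meson Suc_ile_eq less_imp_le)
    qed
  qed
  also have "(\<Union>n. {\<omega> \<in> space M. Z n \<omega> \<in> S}) = {\<omega> \<in> space M. T \<omega> < \<infinity>}"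
  proof safe
    fix \<omega> n assume "\<omega> \<in> space M" "Z n \<omega> \<in> S"
    then show "T \<omega> < \<infinity>" using T[of \<omega> n] by (cases "T \<omega>") auto
  next
    fix \<omega> assume "\<omega> \<in> space M" "T \<omega> < \<infinity>"
    then obtain n where "T \<omega> = enat n" by auto
    then have "Z n \<omega> \<in> S" using T[of \<omega> n] \<open>\<omega> \<in> space M\<close> by simp
    then show "\<omega> \<in> (\<Union>n. {\<omega> \<in> space M. Z n \<omega> \<in> S})" using \<open>\<omega> \<in> space M\<close> by blast
  qed
  finally show ?thesis by (simp add: absorption_prob_def)
qed

end

section \<open>Increments of the power function\<close>

lemma powr_diff_bounds:
  fixes x y \<alpha> :: real
  assumes "0 < y" "y \<le> x" "1 \<le> \<alpha>"
  shows "\<alpha> * y powr (\<alpha> - 1) * (x - y) \<le> x powr \<alpha> - y powr \<alpha>"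
    and "x powr \<alpha> - y powr \<alpha> \<le> \<alpha> * x powr (\<alpha> - 1) * (x - y)"
proof -
  have "\<alpha> * y powr (\<alpha> - 1) * (x - y) \<le> x powr \<alpha> - y powr \<alpha> \<and>
    x powr \<alpha> - y powr \<alpha> \<le> \<alpha> * x powr (\<alpha> - 1) * (x - y)"
  proof (cases "x = y")
    case False
    then have "y < x" using assms by simp
    then obtain z where z: "y < z" "z < x"
      "x powr \<alpha> - y powr \<alpha> = (x - y) * (\<alpha> * z powr (\<alpha> - 1))"
      using assms by (auto dest!: MVT2[of y x "\<lambda>t. t powr \<alpha>" "\<lambda>t. \<alpha> * t powr (\<alpha> - 1)"]
          intro: has_real_derivative_powr)
    have "y powr (\<alpha> - 1) \<le> z powr (\<alpha> - 1)" "z powr (\<alpha> - 1) \<le> x powr (\<alpha> - 1)"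
      using z assms by (auto intro: powr_mono2)
    then show ?thesis
      using z assms by (auto simp: mult_ac intro!: mult_left_mono)
  qed simp
  then show "\<alpha> * y powr (\<alpha> - 1) * (x - y) \<le> x powr \<alpha> - y powr \<alpha>"
    "x powr \<alpha> - y powr \<alpha> \<le> \<alpha> * x powr (\<alpha> - 1) * (x - y)" by auto
qed

text \<open>Convexity of the power function: moving an interval to the right without changing its
  length cannot decrease the increment over it.\<close>

lemma powr_diff_mono_shift:
  fixes x y c \<alpha> :: real
  assumes "0 < y" "y \<le> x" "1 \<le> \<alpha>" "0 \<le> c"
  shows "x powr \<alpha> - y powr \<alpha> \<le> (x + c) powr \<alpha> - (y + c) powr \<alpha>"
proof -
  have "(\<lambda>t. (x + t) powr \<alpha> - (y + t) powr \<alpha>) 0 \<le> (\<lambda>t. (x + t) powr \<alpha> - (y + t) powr \<alpha>) c"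
  proof (rule DERIV_nonneg_imp_nondecreasing[OF \<open>0 \<le> c\<close>])
    fix t :: real assume t: "0 \<le> t" "t \<le> c"
    have "((\<lambda>t. (x + t) powr \<alpha> - (y + t) powr \<alpha>) has_real_derivative
        \<alpha> * (x + t) powr (\<alpha> - 1) - \<alpha> * (y + t) powr (\<alpha> - 1)) (at t)"
      using assms t by (auto intro!: derivative_eq_intros)
    moreover have "\<alpha> * (y + t) powr (\<alpha> - 1) \<le> \<alpha> * (x + t) powr (\<alpha> - 1)"
      using assms t by (intro mult_left_mono powr_mono2) auto
    ultimately show "\<exists>d. ((\<lambda>t. (x + t) powr \<alpha> - (y + t) powr \<alpha>) has_real_derivative d) (at t) \<and> 0 \<le> d"
      by fastforce
  qed
  then show ?thesis by simp
qed

text \<open>Both bases tend to \<open>c\<close> and differ by \<open>A n * (u - v)\<close>, so the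
  quotient tends to the derivative of the power at \<open>c\<close> times \<open>u - v\<close>. The
  bounds of \<open>powr_diff_bounds\<close> squeeze it.\<close>

lemma powr_diff_quotient_tendsto:
  fixes A C :: "nat \<Rightarrow> real" and u v c \<alpha> :: real
  assumes A: "A \<longlonglongrightarrow> 0" "\<And>n. 0 < A n" and C: "C \<longlonglongrightarrow> c" "0 < c"
    and uv: "0 \<le> v" "v \<le> u" and \<alpha>: "1 \<le> \<alpha>"
  shows "(\<lambda>n. ((A n * u + C n) powr \<alpha> - (A n * v + C n) powr \<alpha>) / A n)
    \<longlonglongrightarrow> \<alpha> * c powr (\<alpha> - 1) * (u - v)"
proof -
  have lim: "(\<lambda>n. \<alpha> * (A n * w + C n) powr (\<alpha> - 1) * (u - v)) \<longlonglongrightarrow>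
      \<alpha> * (0 * w + c) powr (\<alpha> - 1) * (u - v)" for w
    using C by (intro tendsto_intros A) auto
  have "\<forall>\<^sub>F n in sequentially. C n > 0"
    using order_tendstoD(1)[OF C] .
  then have bounds: "\<forall>\<^sub>F n in sequentially.
      \<alpha> * (A n * v + C n) powr (\<alpha> - 1) * (u - v)
        \<le> ((A n * u + C n) powr \<alpha> - (A n * v + C n) powr \<alpha>) / A n \<and>
      ((A n * u + C n) powr \<alpha> - (A n * v + C n) powr \<alpha>) / A n
        \<le> \<alpha> * (A n * u + C n) powr (\<alpha> - 1) * (u - v)"
  proof eventually_elim
    case (elim n)
    have 1: "0 < A n * v + C n" "A n * v + C n \<le> A n * u + C n"
      using elim A(2)[of n] uv by (auto intro!: add_nonneg_pos mult_left_mono)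
    have 2: "A n * u + C n - (A n * v + C n) = A n * (u - v)" by (simp add: algebra_simps)
    show ?case
      using powr_diff_bounds[OF 1 \<alpha>] A(2)[of n] unfolding 2 by (simp add: field_simps)
  qed
  show ?thesis
    by (rule tendsto_sandwich[where f = "\<lambda>n. \<alpha> * (A n * v + C n) powr (\<alpha> - 1) * (u - v)"
          and h = "\<lambda>n. \<alpha> * (A n * u + C n) powr (\<alpha> - 1) * (u - v)"])
       (use bounds lim[of u] lim[of v] in \<open>auto elim: eventually_mono\<close>)
qed

section \<open>The closed form of the composed generating functions\<close>

lemma gw_A_0 [simp]: "gw_A a 0 = 1"
  and gw_A_Suc: "gw_A a (Suc n) = gw_A a n * a (Suc n)"
  and gw_C_0 [simp]: "gw_C a c 0 = 0"
  and gw_C_Suc: "gw_C a c (Suc n) = gw_C a c n + gw_A a n * c (Suc n)"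
  by (simp_all add: gw_A_def gw_C_def)

text \<open>The composition of the first \<open>n\<close> offspring generating functions, with the
  closed form taken as the definition; \<open>F_0\<close> and \<open>F_Suc\<close> are the recursion
  that identifies it.\<close>

definition gw_F :: "real \<Rightarrow> real \<Rightarrow> (nat \<Rightarrow> real) \<Rightarrow> (nat \<Rightarrow> real) \<Rightarrow> nat \<Rightarrow> real \<Rightarrow> real" where
  "gw_F \<alpha> r a c n s = r - (gw_A a n * (r - s) powr (1 / \<alpha>) + gw_C a c n) powr \<alpha>"

locale gw_theta_regular = gw_theta_process +
  fixes \<alpha> :: real
  assumes theta: "- 1 < \<theta>" "\<theta> < 0"
    and r: "r > 1"
    and alpha: "\<alpha> = - 1 / \<theta>"
    and a: "\<And>n. n \<ge> 1 \<Longrightarrow> 0 < a n \<and> a n < 1"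
    and c: "\<And>n. n \<ge> 1 \<Longrightarrow> (1 - a n) * (r - 1) powr (- \<theta>) \<le> c n \<and>
                            c n \<le> (1 - a n) * r powr (- \<theta>)"
begin

lemma alpha_gt_1: "\<alpha> > 1"
  using theta by (simp add: alpha field_simps)

lemma theta_eq: "- \<theta> = 1 / \<alpha>"
  using theta by (simp add: alpha field_simps)

lemma c_bounds:
  assumes "n \<ge> 1"
  shows "(1 - a n) * (r - 1) powr (1 / \<alpha>) \<le> c n" "c n \<le> (1 - a n) * r powr (1 / \<alpha>)"
  using c[OF assms] by (simp_all add: theta_eq)

lemma c_nonneg: "n \<ge> 1 \<Longrightarrow> c n \<ge> 0"
  using c_bounds(1)[of n] a[of n]
  by (meson diff_ge_0_iff_ge less_imp_le mult_nonneg_nonneg order_trans powr_ge_zero)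

abbreviation "f n s \<equiv> gw_gen \<theta> r (a n) (c n) s"
abbreviation "F n s \<equiv> gw_F \<alpha> r a c n s"
abbreviation "A\<^sub>n n \<equiv> gw_A a n"
abbreviation "C\<^sub>n n \<equiv> gw_C a c n"

lemma f_eq: "f n s = r - (a n * (r - s) powr (1 / \<alpha>) + c n) powr \<alpha>"
  unfolding gw_gen_def theta_eq alpha[symmetric] ..

lemma A_pos: "A\<^sub>n n > 0"
  by (induction n) (auto simp: gw_A_Suc a)

lemma A_neq_0 [simp]: "A\<^sub>n n \<noteq> 0"
  using A_pos[of n] by simp

lemma A_Suc_le: "A\<^sub>n (Suc n) \<le> A\<^sub>n n"
  using a[of "Suc n"] A_pos[of n] by (simp add: gw_A_Suc mult_le_cancel_left1 mult.commute)

lemma A_le_1: "A\<^sub>n n \<le> 1"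
proof (induction n)
  case (Suc n)
  then show ?case using A_Suc_le[of n] by simp
qed simp

text \<open>Weighting the bounds on c_{i} by A_{i-1} makes them telescope: A_{i-1} (1 - a_i) =
  A_{i-1} - A_i, and these differences add up to 1 - A_n.\<close>

lemma C_bounds:
  "(1 - A\<^sub>n n) * (r - 1) powr (1 / \<alpha>) \<le> C\<^sub>n n"
  "C\<^sub>n n \<le> (1 - A\<^sub>n n) * r powr (1 / \<alpha>)"
proof (induction n)
  case (Suc n)
  {
    case 1
    have "A\<^sub>n n * ((1 - a (Suc n)) * (r - 1) powr (1 / \<alpha>)) \<le> A\<^sub>n n * c (Suc n)"
      using A_pos[of n] c_bounds(1)[of "Suc n"] by (intro mult_left_mono) auto
    then show ?case using Suc(1) by (simp add: gw_A_Suc gw_C_Suc algebra_simps)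
  next
    case 2
    have "A\<^sub>n n * c (Suc n) \<le> A\<^sub>n n * ((1 - a (Suc n)) * r powr (1 / \<alpha>))"
      using A_pos[of n] c_bounds(2)[of "Suc n"] by (intro mult_left_mono) auto
    then show ?case using Suc(2) by (simp add: gw_A_Suc gw_C_Suc algebra_simps)
  }
qed simp_all

lemma C_nonneg: "C\<^sub>n n \<ge> 0"
  using C_bounds(1)[of n] A_le_1[of n]
  by (meson diff_ge_0_iff_ge mult_nonneg_nonneg order_trans powr_ge_zero)

lemma powr_alpha_inverse [simp]:
  "0 \<le> x \<Longrightarrow> (x powr (1 / \<alpha>)) powr \<alpha> = x" "0 \<le> x \<Longrightarrow> (x powr \<alpha>) powr (1 / \<alpha>) = x"
  using alpha_gt_1 by (simp_all add: powr_powr)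

text \<open>Up to the factor \<open>1 - b\<close>, \<open>x\<close> lies between the powers of
  \<open>r - 1\<close> and of \<open>r\<close>, and so does the power of \<open>r - s\<close>; the
  sum is a convex combination. The pair \<open>(b, x)\<close> will be (a_n, c_n), (A_n, C_n) or the
  pair of limits.\<close>

lemma interpolation_bounds:
  fixes b x s :: real
  assumes "0 \<le> b" "b \<le> 1" "0 \<le> s" "s \<le> 1"
    and "(1 - b) * (r - 1) powr (1 / \<alpha>) \<le> x" "x \<le> (1 - b) * r powr (1 / \<alpha>)"
  shows "(r - 1) powr (1 / \<alpha>) \<le> b * (r - s) powr (1 / \<alpha>) + x"
    "b * (r - s) powr (1 / \<alpha>) + x \<le> r powr (1 / \<alpha>)"
proof -
  have "b * (r - 1) powr (1 / \<alpha>) \<le> b * (r - s) powr (1 / \<alpha>)"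
    "b * (r - s) powr (1 / \<alpha>) \<le> b * r powr (1 / \<alpha>)"
    using assms r alpha_gt_1 by (auto intro!: mult_left_mono powr_mono2)
  then show "(r - 1) powr (1 / \<alpha>) \<le> b * (r - s) powr (1 / \<alpha>) + x"
    "b * (r - s) powr (1 / \<alpha>) + x \<le> r powr (1 / \<alpha>)"
    using assms by (auto simp: algebra_simps)
qed

lemma interpolation_powr_bounds:
  fixes b x s :: real
  assumes "0 \<le> b" "b \<le> 1" "0 \<le> s" "s \<le> 1"
    and "(1 - b) * (r - 1) powr (1 / \<alpha>) \<le> x" "x \<le> (1 - b) * r powr (1 / \<alpha>)"
  shows "0 \<le> r - (b * (r - s) powr (1 / \<alpha>) + x) powr \<alpha>"
    "r - (b * (r - s) powr (1 / \<alpha>) + x) powr \<alpha> \<le> 1"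
proof -
  let ?y = "b * (r - s) powr (1 / \<alpha>) + x"
  note * = interpolation_bounds[OF assms]
  have "0 \<le> ?y" using *(1) order_trans powr_ge_zero by blast
  then have "?y powr \<alpha> \<le> (r powr (1 / \<alpha>)) powr \<alpha>" "((r - 1) powr (1 / \<alpha>)) powr \<alpha> \<le> ?y powr \<alpha>"
    using * alpha_gt_1 by (auto intro!: powr_mono2)
  then show "0 \<le> r - ?y powr \<alpha>" "r - ?y powr \<alpha> \<le> 1" using r by simp_all
qed

lemma f_bounds:
  assumes "n \<ge> 1" "0 \<le> s" "s \<le> 1"
  shows "0 \<le> f n s" "f n s \<le> 1"
  using interpolation_powr_bounds[OF _ _ assms(2,3) c_bounds[OF assms(1)]] a[OF assms(1)]
  by (auto simp: f_eq)

lemma F_bounds: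
  assumes "0 \<le> s" "s \<le> 1"
  shows "0 \<le> F n s" "F n s \<le> 1"
  using interpolation_powr_bounds[OF less_imp_le[OF A_pos] A_le_1 assms C_bounds]
  by (auto simp: gw_F_def)

lemma F_0: "s \<le> 1 \<Longrightarrow> F 0 s = s"
  using r by (simp add: gw_F_def)

text \<open>The affine expression is nonnegative, so the power 1/\<alpha> undoes the power \<alpha>
  and the coefficients of the affine maps compose. The newest generation is the innermost map, which
  is the order in which conditioning on \<open>Z n\<close> produces it.\<close>

lemma F_Suc:
  assumes "0 \<le> s" "s \<le> 1"
  shows "F (Suc n) s = F n (f (Suc n) s)"
proof -
  have "0 \<le> a (Suc n) * (r - s) powr (1 / \<alpha>) + c (Suc n)"
    using a[of "Suc n"] c_nonneg[of "Suc n"] by simp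
  then have "(r - f (Suc n) s) powr (1 / \<alpha>) = a (Suc n) * (r - s) powr (1 / \<alpha>) + c (Suc n)"
    by (simp add: f_eq)
  then show ?thesis
    by (simp add: gw_F_def gw_A_Suc gw_C_Suc algebra_simps)
qed

section \<open>The law of the population size and of the absorption times\<close>

lemma nn_integral_gw_weight_Z:
  "0 \<le> s \<Longrightarrow> s \<le> 1 \<Longrightarrow> (\<integral>\<^sup>+\<omega>. gw_weight (ennreal s) (Z n \<omega>) \<partial>M) = ennreal (F n s)"
\<comment> \<open>The induction hypothesis is applied at \<open>f (Suc n) s\<close> in place of
  \<open>s\<close>.\<close>
proof (induction n arbitrary: s)
  case 0
  have "(\<integral>\<^sup>+\<omega>. gw_weight (ennreal s) (Z 0 \<omega>) \<partial>M) = (\<integral>\<^sup>+\<omega>. ennreal s \<partial>M)"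
    by (rule nn_integral_cong) (simp add: Z_0)
  then show ?case using 0 by (simp add: F_0 emeasure_space_1)
next
  case (Suc n)
  have "(\<integral>\<^sup>+\<omega>. gw_weight (ennreal s) (Z (Suc n) \<omega>) \<partial>M) =
      (\<integral>\<^sup>+\<omega>. gw_weight (ennreal (f (Suc n) s)) (Z n \<omega>) \<partial>M)"
    unfolding nn_integral_branching[OF nn_integral_gw_weight_xi[of "Suc n" s, simplified, OF Suc.prems], symmetric]
    by (rule nn_integral_cong) (rule gw_weight_Z_Suc)
  also have "\<dots> = ennreal (F n (f (Suc n) s))"
    using Suc.prems by (intro Suc.IH f_bounds) auto
  finally show ?case using Suc.prems by (simp add: F_Suc)
qed

lemma gw_weight_bounds:
  "0 \<le> s \<Longrightarrow> s \<le> 1 \<Longrightarrow> 0 \<le> gw_weight s z" "0 \<le> s \<Longrightarrow> s \<le> 1 \<Longrightarrow> gw_weight s z \<le> 1" for s :: real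
  by (cases z; simp add: power_le_one)+

lemma ennreal_gw_weight: "0 \<le> s \<Longrightarrow> ennreal (gw_weight s z) = gw_weight (ennreal s) z"
  by (cases z) (simp_all add: ennreal_power)

text \<open>Since 0^0 = 1, the weight at \<open>s = 0\<close> singles out extinction, which gives
  the extinction probability as \<open>F n 0\<close>.\<close>

lemma gw_weight_zero: "gw_weight 0 z = indicator {Some 0} z"
  by (cases z) (auto simp: power_0_left indicator_def)

lemma integrable_gw_weight_Z:
  fixes s :: real
  assumes "0 \<le> s" "s \<le> 1"
  shows "integrable M (\<lambda>\<omega>. gw_weight s (Z n \<omega>))"
  using gw_weight_bounds[OF assms]
  by (intro integrable_const_bound[of _ 1]) auto

lemma integral_gw_weight_Z:
  fixes s :: real
  assumes "0 \<le> s" "s \<le> 1"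
  shows "(LINT \<omega>|M. gw_weight s (Z n \<omega>)) = F n s"
  using assms gw_weight_bounds[OF assms] F_bounds[OF assms]
  by (subst integral_eq_nn_integral)
     (auto simp: ennreal_gw_weight nn_integral_gw_weight_Z)

lemma prob_Z_extinct: "prob {\<omega> \<in> space M. Z n \<omega> = Some 0} = F n 0"
proof -
  have "prob {\<omega> \<in> space M. Z n \<omega> = Some 0} = (LINT \<omega>|M. indicator {\<omega> \<in> space M. Z n \<omega> = Some 0} \<omega>)"
    by simp
  also have "\<dots> = (LINT \<omega>|M. gw_weight 0 (Z n \<omega>))"
    by (rule Bochner_Integration.integral_cong) (auto simp: gw_weight_zero indicator_def)
  finally show ?thesis by (simp add: integral_gw_weight_Z)
qed

lemma prob_Z_not_cemetery: "prob {\<omega> \<in> space M. Z n \<omega> \<noteq> None} = F n 1"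
proof -
  have "prob {\<omega> \<in> space M. Z n \<omega> \<noteq> None} = (LINT \<omega>|M. indicator {\<omega> \<in> space M. Z n \<omega> \<noteq> None} \<omega>)"
    by simp
  also have "\<dots> = (LINT \<omega>|M. gw_weight 1 (Z n \<omega>))"
    by (rule Bochner_Integration.integral_cong) (auto simp: indicator_def)
  finally show ?thesis by (simp add: integral_gw_weight_Z)
qed

lemma prob_Z_cemetery: "prob {\<omega> \<in> space M. Z n \<omega> = None} = 1 - F n 1"
proof -
  have "prob (space M - {\<omega> \<in> space M. Z n \<omega> \<noteq> None}) = 1 - F n 1"
    by (subst prob_compl) (simp_all add: prob_Z_not_cemetery del: not_None_eq)
  also have "space M - {\<omega> \<in> space M. Z n \<omega> \<noteq> None} = {\<omega> \<in> space M. Z n \<omega> = None}" by auto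
  finally show ?thesis .
qed

lemma prob_Z_absorbed: "prob {\<omega> \<in> space M. Z n \<omega> \<in> {None, Some 0}} = 1 - F n 1 + F n 0"
proof -
  have "prob ({\<omega> \<in> space M. Z n \<omega> = None} \<union> {\<omega> \<in> space M. Z n \<omega> = Some 0}) = 1 - F n 1 + F n 0"
    by (subst finite_measure_Union) (auto simp: prob_Z_cemetery prob_Z_extinct)
  also have "{\<omega> \<in> space M. Z n \<omega> = None} \<union> {\<omega> \<in> space M. Z n \<omega> = Some 0} =
    {\<omega> \<in> space M. Z n \<omega> \<in> {None, Some 0}}" by auto
  finally show ?thesis .
qed

lemma prob_tau_gt: "prob {\<omega> \<in> space M. tau Z \<omega> > enat n} = F n 1 - F n 0"
proof -
  have "prob (space M - {\<omega> \<in> space M. Z n \<omega> \<in> {None, Some 0}}) = F n 1 - F n 0"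
    by (subst prob_compl) (auto simp: prob_Z_absorbed simp del: insert_iff)
  also have "space M - {\<omega> \<in> space M. Z n \<omega> \<in> {None, Some 0}} = {\<omega> \<in> space M. tau Z \<omega> > enat n}"
    by (auto simp: tau_gt_iff)
  finally show ?thesis .
qed

text \<open>Subtracting the weight at 0 removes exactly the absorbed states: \<Delta> has weight 0
  in both terms, and the state 0 has weight 1 in both. The indicator hides the arbitrary value of
  \<open>the None\<close>.\<close>

lemma integral_power_Z_alive:
  assumes "0 \<le> s" "s \<le> 1"
  shows "(LINT \<omega>:{\<omega> \<in> space M. tau Z \<omega> > enat n}|M. s ^ the (Z n \<omega>)) = F n s - F n 0"
proof -
  have "(LINT \<omega>:{\<omega> \<in> space M. tau Z \<omega> > enat n}|M. s ^ the (Z n \<omega>)) =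
      (LINT \<omega>|M. gw_weight s (Z n \<omega>) - gw_weight 0 (Z n \<omega>))"
    unfolding set_lebesgue_integral_def
  proof (rule Bochner_Integration.integral_cong)
    fix \<omega> assume "\<omega> \<in> space M"
    then show "indicat_real {\<omega> \<in> space M. tau Z \<omega> > enat n} \<omega> *\<^sub>R s ^ the (Z n \<omega>) =
      gw_weight s (Z n \<omega>) - gw_weight 0 (Z n \<omega>)"
      by (cases "Z n \<omega>") (auto simp: tau_gt_iff indicator_def power_0_left)
  qed simp
  then show ?thesis
    using assms by (simp add: integral_gw_weight_Z integrable_gw_weight_Z)
qed

section \<open>The mean population size\<close>

abbreviation "dF n \<equiv> A\<^sub>n n * (r - 1) powr (1 / \<alpha> - 1) *
  (A\<^sub>n n * (r - 1) powr (1 / \<alpha>) + C\<^sub>n n) powr (\<alpha> - 1)"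

text \<open>Because \<open>r > 1\<close>, the closed form is differentiable at 1 from both sides.
  The outer factor \<alpha> cancels against the inner factor 1/\<alpha>.\<close>

lemma F_has_derivative_at_1: "(F n has_real_derivative dF n) (at 1)"
proof -
  have pos: "0 < A\<^sub>n n * (r - 1) powr (1 / \<alpha>) + C\<^sub>n n"
    using A_pos[of n] C_nonneg[of n] r by (simp add: add_pos_nonneg)
  have "((\<lambda>s. r - (A\<^sub>n n * (r - s) powr (1 / \<alpha>) + C\<^sub>n n) powr \<alpha>) has_real_derivative
      - (\<alpha> * (A\<^sub>n n * (r - 1) powr (1 / \<alpha>) + C\<^sub>n n) powr (\<alpha> - 1) *
          (A\<^sub>n n * (1 / \<alpha> * (r - 1) powr (1 / \<alpha> - 1) * (- 1))))) (at 1)"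
    using r pos alpha_gt_1 by (auto intro!: derivative_eq_intros)
  moreover have "- (\<alpha> * (A\<^sub>n n * (r - 1) powr (1 / \<alpha>) + C\<^sub>n n) powr (\<alpha> - 1) *
          (A\<^sub>n n * (1 / \<alpha> * (r - 1) powr (1 / \<alpha> - 1) * (- 1)))) = dF n"
    using alpha_gt_1 by (simp add: mult_ac)
  moreover have "F n = (\<lambda>s. r - (A\<^sub>n n * (r - s) powr (1 / \<alpha>) + C\<^sub>n n) powr \<alpha>)"
    by (simp add: gw_F_def fun_eq_iff)
  ultimately show ?thesis by simp
qed

text \<open>The mean is the left derivative of the generating function at \<open>1\<close>: the difference
  quotients \<open>(1 - t\<^sup>j) / (1 - t) = \<Sum>i<j. t\<^sup>i\<close> increase to \<open>j\<close> as \<open>t\<close> increases to \<open>1\<close>.\<close>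

lemma nn_integral_Z:
  "(\<integral>\<^sup>+\<omega>. ennreal (case Z n \<omega> of None \<Rightarrow> 0 | Some j \<Rightarrow> real j) \<partial>M) = ennreal (dF n)"
proof -
  \<comment> \<open>Any sequence in [0, 1) increasing to 1 would do: it stays where the generating
    function identity holds and never makes the denominator \<open>1 - t k\<close> vanish.\<close>
  define t :: "nat \<Rightarrow> real" where "t k = 1 - 1 / real (Suc k)" for k
  have t: "0 \<le> t k" "t k < 1" "t k \<le> t (Suc k)" for k
    by (auto simp: t_def field_simps)
  have "(\<lambda>k. 1 - 1 / real (Suc k)) \<longlonglongrightarrow> 1 - 0"
    by (intro tendsto_diff tendsto_const LIMSEQ_Suc[OF lim_1_over_n])
  then have t_lim: "t \<longlonglongrightarrow> 1" by (simp add: t_def[abs_def])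
  define D :: "nat \<Rightarrow> nat option \<Rightarrow> real" where
    "D k z = (case z of None \<Rightarrow> 0 | Some j \<Rightarrow> \<Sum>i<j. t k ^ i)" for k z
  have D_eq: "D k z = (gw_weight 1 z - gw_weight (t k) z) / (1 - t k)" for k z
    using t(2)[of k] by (cases z) (simp_all add: D_def one_diff_power_eq)
  have D_nonneg: "0 \<le> D k z" for k z
    by (cases z) (auto simp: D_def t intro!: sum_nonneg)
  have "(\<lambda>k. \<integral>\<^sup>+\<omega>. ennreal (D k (Z n \<omega>)) \<partial>M) \<longlonglongrightarrow>
      (\<integral>\<^sup>+\<omega>. ennreal (case Z n \<omega> of None \<Rightarrow> 0 | Some j \<Rightarrow> real j) \<partial>M)"
  proof (rule nn_integral_LIMSEQ)
    show "incseq (\<lambda>k \<omega>. ennreal (D k (Z n \<omega>)))"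
    proof (rule incseq_SucI, rule le_funI)
      fix k \<omega>
      show "ennreal (D k (Z n \<omega>)) \<le> ennreal (D (Suc k) (Z n \<omega>))"
        by (cases "Z n \<omega>") (auto simp: D_def t intro!: ennreal_leI sum_mono power_mono)
    qed
    show "(\<lambda>\<omega>. ennreal (D k (Z n \<omega>))) \<in> borel_measurable M" for k
      by measurable
    show "(\<lambda>k. ennreal (D k (Z n \<omega>))) \<longlonglongrightarrow> ennreal (case Z n \<omega> of None \<Rightarrow> 0 | Some j \<Rightarrow> real j)" for \<omega>
    proof (intro tendsto_ennrealI, cases "Z n \<omega>")
      case (Some j)
      have "(\<lambda>k. \<Sum>i<j. t k ^ i) \<longlonglongrightarrow> (\<Sum>i<j. 1 ^ i)"
        by (intro tendsto_intros t_lim)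
      then show "(\<lambda>k. D k (Z n \<omega>)) \<longlonglongrightarrow> (case Z n \<omega> of None \<Rightarrow> 0 | Some j \<Rightarrow> real j)"
        by (simp add: D_def Some)
    qed (simp add: D_def)
  qed
  moreover have "(\<integral>\<^sup>+\<omega>. ennreal (D k (Z n \<omega>)) \<partial>M) = ennreal ((F n (t k) - F n 1) / (t k - 1))" for k
  proof -
    have "(\<integral>\<^sup>+\<omega>. ennreal (D k (Z n \<omega>)) \<partial>M) = ennreal (LINT \<omega>|M. D k (Z n \<omega>))"
      using t[of k] D_nonneg
      by (intro nn_integral_eq_integral) (auto simp: D_eq intro!: integrable_gw_weight_Z
          integrable_divide_zero Bochner_Integration.integrable_diff)
    also have "(LINT \<omega>|M. D k (Z n \<omega>)) = (F n 1 - F n (t k)) / (1 - t k)"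
      using t[of k] by (simp add: D_eq integral_gw_weight_Z integrable_gw_weight_Z)
    also have "\<dots> = (F n (t k) - F n 1) / (t k - 1)"
      by (metis minus_diff_eq minus_divide_divide)
    finally show ?thesis .
  qed
  moreover have "(\<lambda>k. ennreal ((F n (t k) - F n 1) / (t k - 1))) \<longlonglongrightarrow> ennreal (dF n)"
  proof (rule tendsto_ennrealI)
    have "((\<lambda>s. (F n s - F n 1) / (s - 1)) \<longlongrightarrow> dF n) (at 1)"
      using F_has_derivative_at_1[of n] by (simp add: has_field_derivative_iff)
    moreover have "filterlim t (at 1) sequentially"
      using t_lim t(2) by (auto simp: filterlim_at less_imp_neq)
    ultimately show "(\<lambda>k. (F n (t k) - F n 1) / (t k - 1)) \<longlonglongrightarrow> dF n"
      by (rule filterlim_compose)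
  qed
  ultimately show ?thesis
    using LIMSEQ_unique by simp
qed

lemma dF_nonneg: "0 \<le> dF n"
  using A_pos[of n] by simp

lemma has_bochner_integral_Z:
  "has_bochner_integral M (\<lambda>\<omega>. case Z n \<omega> of None \<Rightarrow> 0 | Some j \<Rightarrow> real j) (dF n)"
  by (rule has_bochner_integral_nn_integral)
     (auto simp: nn_integral_Z dF_nonneg split: option.split)

text \<open>An extinct population contributes 0 to the mean, so excluding extinction in addition to
  the cemetery does not change the integral.\<close>

lemma integral_Z_alive:
  "(LINT \<omega>:{\<omega> \<in> space M. tau Z \<omega> > enat n}|M. real (the (Z n \<omega>))) = dF n"
  "(LINT \<omega>:{\<omega> \<in> space M. tau_D Z \<omega> > enat n}|M. real (the (Z n \<omega>))) = dF n"
proof -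
  have *: "(LINT \<omega>|M. (case Z n \<omega> of None \<Rightarrow> 0 | Some j \<Rightarrow> real j)) = dF n"
    using has_bochner_integral_Z by (rule has_bochner_integral_integral_eq)
  show "(LINT \<omega>:{\<omega> \<in> space M. tau Z \<omega> > enat n}|M. real (the (Z n \<omega>))) = dF n"
    unfolding set_lebesgue_integral_def *[symmetric]
    by (rule Bochner_Integration.integral_cong)
       (auto simp: tau_gt_iff indicator_def split: option.split)
  show "(LINT \<omega>:{\<omega> \<in> space M. tau_D Z \<omega> > enat n}|M. real (the (Z n \<omega>))) = dF n"
    unfolding set_lebesgue_integral_def *[symmetric]
    by (rule Bochner_Integration.integral_cong)
       (auto simp: tau_D_gt_iff indicator_def split: option.split)
qed


section \<open>Existence of the limits, and how often the population size changes\<close>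

lemma convergent_A: "convergent A\<^sub>n"
proof (rule Bseq_monoseq_convergent)
  show "Bseq A\<^sub>n"
    using A_pos A_le_1 by (intro BseqI'[of _ 1]) (simp add: less_imp_le)
  show "monoseq A\<^sub>n"
    using A_Suc_le by (auto simp: monoseq_Suc)
qed

lemma convergent_C: "convergent C\<^sub>n"
proof (rule Bseq_monoseq_convergent)
  have "C\<^sub>n n \<le> r powr (1 / \<alpha>)" for n
    using C_bounds(2)[of n] mult_right_mono[of "1 - A\<^sub>n n" 1 "r powr (1 / \<alpha>)"] A_pos[of n]
    by simp
  then show "Bseq C\<^sub>n"
    by (intro BseqI'[of _ "r powr (1 / \<alpha>)"]) (simp add: C_nonneg)
  show "monoseq C\<^sub>n"
    using A_pos c_nonneg by (auto simp: monoseq_Suc gw_C_Suc less_imp_le)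
qed

text \<open>The coefficient of \<open>s\<close> is bounded below by comparing two estimates of
  f_n(s) - f_n(0) for small \<open>s\<close>: the power series gives at most
  \<open>(p n 1 + s) * s\<close>, the closed form at least \<open>a n powr \<alpha> * s\<close>.
  Then \<open>s\<close> tends to 0.\<close>

lemma p1_bounds:
  assumes n: "n \<ge> 1"
  shows "a n powr \<alpha> \<le> p n 1" "p n 1 \<le> 1"
proof -
  show "p n 1 \<le> 1" using offspring[OF n, of 0 1] prob_le_1 by metis
  have p0: "p n 0 = f n 0"
    using pgf[OF n, of 0] powser_sums_zero[of "p n"] by (simp add: sums_unique2)
  have *: "a n powr \<alpha> \<le> p n 1 + s" if s: "0 < s" "s \<le> 1" for s
  proof -
    let ?b = "\<lambda>s. a n * (r - s) powr (1 / \<alpha>)"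
    \<comment> \<open>A majorant of the series at \<open>s\<close>: the terms of index 0 and 1 are
      kept, and those of index at least 2 are bounded by \<open>s\<^sup>2\<close> times the
      coefficient. Extending this last part to all indices only enlarges the bound and lets it sum
      to \<open>f n 1\<close>.\<close>
    have S: "(\<lambda>j. (if j = 0 then p n 0 else 0) + (if j = 1 then p n 1 * s else 0) + s\<^sup>2 * (p n j * 1 ^ j))
        sums (p n 0 + p n 1 * s + s\<^sup>2 * f n 1)"
      using pgf[OF n, of 1] by (intro sums_add sums_mult sums_single) auto
    have "f n s \<le> p n 0 + p n 1 * s + s\<^sup>2 * f n 1"
    proof (rule sums_le[OF _ pgf[OF n] S])
      fix j
      have "s ^ j \<le> s\<^sup>2" if "2 \<le> j" using that s by (intro power_decreasing) auto
      then show "p n j * s ^ j \<le> (if j = 0 then p n 0 else 0) + (if j = 1 then p n 1 * s else 0)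
          + s\<^sup>2 * (p n j * 1 ^ j)"
        using p_nonneg[OF n, of j] s
        by (cases "2 \<le> j") (auto simp: mult.commute[of _ "p n j"] mult_left_mono not_le less_2_cases_iff)
    qed (use s in auto)
    also have "\<dots> \<le> p n 0 + p n 1 * s + s * s"
      using f_bounds[OF n, of 1] s by (simp add: power2_eq_square mult_left_le)
    finally have upper: "f n s - f n 0 \<le> (p n 1 + s) * s"
      by (simp add: p0 algebra_simps)
    \<comment> \<open>Without the constant \<open>c n\<close> the map is exactly linear: its
      \<alpha>-th power is a_n^\<alpha> (r - s). Convexity then allows \<open>c n\<close> to be
      added back.\<close>
    have "a n powr \<alpha> * s = (?b 0) powr \<alpha> - (?b s) powr \<alpha>"
      using a[OF n] s r by (simp add: powr_mult algebra_simps)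
    also have "\<dots> \<le> (?b 0 + c n) powr \<alpha> - (?b s + c n) powr \<alpha>"
      using a[OF n] s r alpha_gt_1 c_nonneg[OF n]
      by (intro powr_diff_mono_shift mult_pos_pos mult_left_mono powr_mono2) auto
    also have "\<dots> = f n s - f n 0" by (simp add: f_eq)
    finally have "a n powr \<alpha> * s \<le> (p n 1 + s) * s" using upper by simp
    then show ?thesis using s by simp
  qed
  show "a n powr \<alpha> \<le> p n 1"
  proof (rule field_le_epsilon)
    fix e :: real assume "0 < e"
    then show "a n powr \<alpha> \<le> p n 1 + e" using *[of "min e 1"] by linarith
  qed
qed

text \<open>If every individual has exactly one child, the size is preserved, so P(Z_{n+1} = Z_n
  \<noteq> \<Delta>) is at least F_n(p) with p the one-child probability. What remains of F_n(1) is
  at most the mean times 1 - p.\<close>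

lemma prob_Z_changes:
  "prob {\<omega> \<in> space M. Z (Suc n) \<omega> \<noteq> Z n \<omega>} \<le> dF n * (\<alpha> * (1 - a (Suc n)))"
proof -
  let ?p = "p (Suc n) 1"
  have [measurable]: "\<xi> (Suc n) k \<in> measurable M (count_space UNIV)" for k
    by (rule measurable_xi) simp
  have p: "0 \<le> ?p" "?p \<le> 1" using p1_bounds[of "Suc n"] p_nonneg[of "Suc n" 1] by auto
  let ?E = "{\<omega> \<in> space M. Z n \<omega> \<noteq> None \<and> Z (Suc n) \<omega> = Z n \<omega>}"
  have "(\<integral>\<^sup>+\<omega>. indicator {Some 1} (\<xi> (Suc n) k \<omega>) \<partial>M) = ennreal ?p" for k
  proof -
    have "(\<integral>\<^sup>+\<omega>. indicator {Some 1} (\<xi> (Suc n) k \<omega>) \<partial>M) =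
        (\<integral>\<^sup>+\<omega>. indicator {\<omega> \<in> space M. \<xi> (Suc n) k \<omega> = Some 1} \<omega> \<partial>M)"
      by (rule nn_integral_cong) (simp add: indicator_def)
    then show ?thesis by (simp add: emeasure_eq_measure offspring)
  qed
  from nn_integral_branching[where h = "indicator {Some 1}", OF this]
  have "ennreal (F n ?p) = (\<integral>\<^sup>+\<omega>. (case Z n \<omega> of None \<Rightarrow> 0
      | Some m \<Rightarrow> \<Prod>k<m. indicator {Some 1} (\<xi> (Suc n) k \<omega>)) \<partial>M)"
    using p by (simp add: nn_integral_gw_weight_Z)
  also have "\<dots> \<le> (\<integral>\<^sup>+\<omega>. indicator ?E \<omega> \<partial>M)"
  proof (rule nn_integral_mono)
    fix \<omega> assume \<omega>: "\<omega> \<in> space M"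
    show "(case Z n \<omega> of None \<Rightarrow> 0 | Some m \<Rightarrow> \<Prod>k<m. indicator {Some 1} (\<xi> (Suc n) k \<omega>))
        \<le> (indicator ?E \<omega> :: ennreal)"
    proof (cases "Z n \<omega>")
      case (Some m)
      show ?thesis
      proof (cases "\<forall>k<m. \<xi> (Suc n) k \<omega> = Some 1")
        case True
        then have "Z (Suc n) \<omega> = Z n \<omega>" by (simp add: Z_Suc[OF \<omega>] Some)
        then show ?thesis using True \<omega> by (simp add: Some)
      next
        case False
        then obtain k where "k < m" "indicator {Some 1} (\<xi> (Suc n) k \<omega>) = (0 :: ennreal)" by auto
        then have *: "(\<Prod>k<m. indicator {Some 1} (\<xi> (Suc n) k \<omega>)) = (0 :: ennreal)"
          by (intro prod_zero) auto
        show ?thesis unfolding Some option.case * by simp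
      qed
    qed simp
  qed
  also have "\<dots> = ennreal (prob ?E)" by (simp add: emeasure_eq_measure)
  finally have E: "F n ?p \<le> prob ?E" by simp
  \<comment> \<open>The cemetery is never left, so a change can only start from another
    state.\<close>
  have "prob {\<omega> \<in> space M. Z (Suc n) \<omega> \<noteq> Z n \<omega>} \<le> prob ({\<omega> \<in> space M. Z n \<omega> \<noteq> None} - ?E)"
    by (rule finite_measure_mono) (auto simp: Z_Suc split: option.splits)
  also have "\<dots> = F n 1 - prob ?E"
    by (subst finite_measure_Diff) (auto simp: prob_Z_not_cemetery simp del: not_None_eq)
  also have "\<dots> \<le> F n 1 - F n ?p" using E by simp
  also have "\<dots> = (LINT \<omega>|M. gw_weight 1 (Z n \<omega>) - gw_weight ?p (Z n \<omega>))"
    using p by (simp add: integral_gw_weight_Z integrable_gw_weight_Z)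
  also have "\<dots> \<le> (LINT \<omega>|M. (case Z n \<omega> of None \<Rightarrow> 0 | Some j \<Rightarrow> real j) * (1 - ?p))"
  proof (rule integral_mono)
    show "gw_weight 1 (Z n \<omega>) - gw_weight ?p (Z n \<omega>) \<le>
        (case Z n \<omega> of None \<Rightarrow> 0 | Some j \<Rightarrow> real j) * (1 - ?p)" for \<omega>
      \<comment> \<open>Bernoulli's inequality in the form 1 - p^j \<le> j (1 - p).\<close>
      using p Bernoulli_inequality[of "?p - 1"] by (cases "Z n \<omega>") (auto simp: algebra_simps)
  qed (use p has_bochner_integral_Z[of n] in
      \<open>auto intro!: Bochner_Integration.integrable_diff integrable_gw_weight_Z integrable_mult_left
        simp: has_bochner_integral_iff\<close>)
  also have "\<dots> = dF n * (1 - ?p)"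
    using has_bochner_integral_Z[of n] by (simp add: has_bochner_integral_iff)
  also have "\<dots> \<le> dF n * (\<alpha> * (1 - a (Suc n)))"
  proof (rule mult_left_mono[OF _ dF_nonneg])
    have "1 - a (Suc n) powr \<alpha> \<le> \<alpha> * (1 - a (Suc n))"
      using powr_diff_bounds(2)[of "a (Suc n)" 1 \<alpha>] a[of "Suc n"] alpha_gt_1 by simp
    then show "1 - ?p \<le> \<alpha> * (1 - a (Suc n))" using p1_bounds[of "Suc n"] by simp
  qed
  finally show ?thesis .
qed

end

section \<open>Passage to the limit\<close>

locale gw_theta_limits = gw_theta_regular +
  fixes A C :: real
  assumes A_lim: "gw_A a \<longlonglongrightarrow> A" and C_lim: "gw_C a c \<longlonglongrightarrow> C"
begin

lemma A_nonneg: "0 \<le> A"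
  by (rule LIMSEQ_le_const[OF A_lim]) (auto intro: less_imp_le A_pos)

lemma A_le: "A \<le> A\<^sub>n n"
  by (rule decseq_ge[OF decseq_SucI A_lim]) (rule A_Suc_le)

lemma A_less_1: "A < 1"
  using A_le[of 1] a[of 1] by (simp add: gw_A_def)

lemma C_limit_bounds:
  "(1 - A) * (r - 1) powr (1 / \<alpha>) \<le> C" "C \<le> (1 - A) * r powr (1 / \<alpha>)"
proof -
  have lim: "(\<lambda>n. (1 - A\<^sub>n n) * x) \<longlonglongrightarrow> (1 - A) * x" for x
    by (intro tendsto_intros A_lim)
  show "(1 - A) * (r - 1) powr (1 / \<alpha>) \<le> C"
    by (rule LIMSEQ_le[OF lim C_lim]) (auto intro: C_bounds)
  show "C \<le> (1 - A) * r powr (1 / \<alpha>)"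
    by (rule LIMSEQ_le[OF C_lim lim]) (auto intro: C_bounds)
qed

text \<open>The base is at least \<open>(r - 1) powr (1 / \<alpha>)\<close>, which is positive since
  \<open>r > 1\<close>. This makes the powers continuous at the limit; for \<open>A = 0\<close> it
  says that \<open>C\<close> is positive.\<close>

lemma base_pos:
  assumes "0 \<le> s" "s \<le> 1"
  shows "0 < A * (r - s) powr (1 / \<alpha>) + C"
  using interpolation_bounds(1)[OF A_nonneg less_imp_le[OF A_less_1] assms C_limit_bounds] r
  by (intro less_le_trans[of 0 "(r - 1) powr (1 / \<alpha>)" "A * (r - s) powr (1 / \<alpha>) + C"]) auto

lemma F_lim:
  assumes "0 \<le> s" "s \<le> 1"
  shows "(\<lambda>n. F n s) \<longlonglongrightarrow> r - (A * (r - s) powr (1 / \<alpha>) + C) powr \<alpha>"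
  unfolding gw_F_def using base_pos[OF assms] by (intro tendsto_intros A_lim C_lim) auto

lemma dF_lim:
  "dF \<longlonglongrightarrow> A * (r - 1) powr (1 / \<alpha> - 1) * (A * (r - 1) powr (1 / \<alpha>) + C) powr (\<alpha> - 1)"
  using base_pos[of 1] by (intro tendsto_intros A_lim C_lim) auto

lemma absorption_prob_tau_0:
  "absorption_prob M (tau_0 Z) = r - (A * r powr (1 / \<alpha>) + C) powr \<alpha>"
proof (rule LIMSEQ_unique)
  show "(\<lambda>n. prob {\<omega> \<in> space M. Z n \<omega> \<in> {Some 0}}) \<longlonglongrightarrow> absorption_prob M (tau_0 Z)"
    by (rule absorption_prob_LIMSEQ) (simp add: tau_0_gt_iff)
  show "(\<lambda>n. prob {\<omega> \<in> space M. Z n \<omega> \<in> {Some 0}}) \<longlonglongrightarrow>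
      r - (A * r powr (1 / \<alpha>) + C) powr \<alpha>"
    using F_lim[of 0] by (simp add: prob_Z_extinct)
qed

lemma absorption_prob_tau_D:
  "absorption_prob M (tau_D Z) = 1 - r + (A * (r - 1) powr (1 / \<alpha>) + C) powr \<alpha>"
proof (rule LIMSEQ_unique)
  show "(\<lambda>n. prob {\<omega> \<in> space M. Z n \<omega> \<in> {None}}) \<longlonglongrightarrow> absorption_prob M (tau_D Z)"
    by (rule absorption_prob_LIMSEQ) (simp add: tau_D_gt_iff)
  show "(\<lambda>n. prob {\<omega> \<in> space M. Z n \<omega> \<in> {None}}) \<longlonglongrightarrow>
      1 - r + (A * (r - 1) powr (1 / \<alpha>) + C) powr \<alpha>"
    using tendsto_diff[OF tendsto_const[of 1] F_lim[of 1]]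
    by (simp add: prob_Z_cemetery algebra_simps)
qed

lemma absorption_prob_tau:
  "absorption_prob M (tau Z) =
    1 - ((A * r powr (1 / \<alpha>) + C) powr \<alpha> - (A * (r - 1) powr (1 / \<alpha>) + C) powr \<alpha>)"
proof (rule LIMSEQ_unique)
  show "(\<lambda>n. prob {\<omega> \<in> space M. Z n \<omega> \<in> {None, Some 0}}) \<longlonglongrightarrow> absorption_prob M (tau Z)"
    by (rule absorption_prob_LIMSEQ) (auto simp: tau_gt_iff)
  show "(\<lambda>n. prob {\<omega> \<in> space M. Z n \<omega> \<in> {None, Some 0}}) \<longlonglongrightarrow>
      1 - ((A * r powr (1 / \<alpha>) + C) powr \<alpha> - (A * (r - 1) powr (1 / \<alpha>) + C) powr \<alpha>)"
    unfolding prob_Z_absorbed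
    using tendsto_add[OF tendsto_diff[OF tendsto_const[of 1] F_lim[of 1]] F_lim[of 0]]
    by (simp add: algebra_simps)
qed

text \<open>The difference is an increment of the \<alpha>-th power over an interval whose length is
  proportional to A_n and whose endpoints tend to \<open>C\<close>, so the limit is a derivative at
  \<open>C\<close>.\<close>

lemma F_diff_scaled_lim:
  assumes A: "A = 0" and s: "0 \<le> s" "s \<le> 1"
  shows "(\<lambda>n. (F n s - F n 0) / A\<^sub>n n) \<longlonglongrightarrow>
    \<alpha> * C powr (\<alpha> - 1) * (r powr (1 / \<alpha>) - (r - s) powr (1 / \<alpha>))"
proof -
  have "(r - s) powr (1 / \<alpha>) \<le> r powr (1 / \<alpha>)"
    using s r alpha_gt_1 by (intro powr_mono2) auto
  from powr_diff_quotient_tendsto[OF A_lim[unfolded A] A_pos C_lim _ powr_ge_zero this]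
  show ?thesis using base_pos[of 0] A alpha_gt_1 by (simp add: gw_F_def)
qed

lemma powr_r_diff_pos: "0 < r powr (1 / \<alpha>) - (r - 1) powr (1 / \<alpha>)"
  using r alpha_gt_1 by (simp add: powr_less_mono2)

text \<open>Dividing the mean and the survival probability by A_n gives both finite nonzero limits,
  in which the power of \<open>C\<close> cancels. The factor \<alpha> in the denominator remains, in
  accordance with the derivative at \<open>s = 1\<close> of the limit in
  \<open>cond_expect_power_Z_lim\<close>.\<close>

lemma cond_expect_Z_lim:
  assumes A: "A = 0"
  shows "(\<lambda>n. cond_expect M (\<lambda>\<omega>. real (the (Z n \<omega>))) {\<omega> \<in> space M. tau Z \<omega> > enat n})
    \<longlonglongrightarrow> (r - 1) powr (1 / \<alpha> - 1) / (\<alpha> * (r powr (1 / \<alpha>) - (r - 1) powr (1 / \<alpha>)))"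
proof -
  have C: "0 < C" using base_pos[of 0] A by simp
  have "(\<lambda>n. (r - 1) powr (1 / \<alpha> - 1) * (A\<^sub>n n * (r - 1) powr (1 / \<alpha>) + C\<^sub>n n) powr (\<alpha> - 1)
        / ((F n 1 - F n 0) / A\<^sub>n n))
    \<longlonglongrightarrow> (r - 1) powr (1 / \<alpha> - 1) * (A * (r - 1) powr (1 / \<alpha>) + C) powr (\<alpha> - 1)
      / (\<alpha> * C powr (\<alpha> - 1) * (r powr (1 / \<alpha>) - (r - 1) powr (1 / \<alpha>)))"
    using base_pos[of 1] powr_r_diff_pos C alpha_gt_1
    by (intro tendsto_intros A_lim C_lim F_diff_scaled_lim A) auto
  then show ?thesis
    using C by (simp add: cond_expect_def integral_Z_alive prob_tau_gt A mult_ac)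
qed

lemma cond_expect_power_Z_lim:
  assumes A: "A = 0" and s: "0 \<le> s" "s \<le> 1"
  shows "(\<lambda>n. cond_expect M (\<lambda>\<omega>. s ^ the (Z n \<omega>)) {\<omega> \<in> space M. tau Z \<omega> > enat n})
    \<longlonglongrightarrow> (r powr (1 / \<alpha>) - (r - s) powr (1 / \<alpha>)) / (r powr (1 / \<alpha>) - (r - 1) powr (1 / \<alpha>))"
proof -
  have C: "0 < C" using base_pos[of 0] A by simp
  have "(\<lambda>n. ((F n s - F n 0) / A\<^sub>n n) / ((F n 1 - F n 0) / A\<^sub>n n))
    \<longlonglongrightarrow> \<alpha> * C powr (\<alpha> - 1) * (r powr (1 / \<alpha>) - (r - s) powr (1 / \<alpha>))
      / (\<alpha> * C powr (\<alpha> - 1) * (r powr (1 / \<alpha>) - (r - 1) powr (1 / \<alpha>)))"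
    using powr_r_diff_pos C alpha_gt_1 s
    by (intro tendsto_divide F_diff_scaled_lim A) auto
  then show ?thesis
    using C alpha_gt_1 s by (simp add: cond_expect_def integral_power_Z_alive prob_tau_gt)
qed

section \<open>The almost sure limit and its law\<close>

text \<open>Since \<open>E(Z\<^sub>n; Z\<^sub>n \<noteq> \<Delta>)\<close> is bounded and \<open>\<Sum>n. (1 - a\<^sub>n)\<close> converges when \<open>A > 0\<close>, the
  probabilities of a change between times \<open>n\<close> and \<open>n + 1\<close> are summable.\<close>

lemma AE_Z_eventually_const:
  assumes A: "0 < A"
  shows "AE \<omega> in M. \<forall>\<^sub>F n in sequentially. Z (Suc n) \<omega> = Z n \<omega>"
proof -
  obtain K where K: "dF n \<le> K" for n
    using convergent_imp_Bseq[OF convergentI[OF dF_lim]] unfolding Bseq_def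
    by (metis abs_le_D1 real_norm_def)
  \<comment> \<open>The decrements of A_n telescope and equal A_n (1 - a_{n+1}), which is at least A
    (1 - a_{n+1}). Since \<open>A\<close> is positive, dividing by it turns them into a summable
    majorant; this is the origin of the constant \<open>K * \<alpha> / A\<close>.\<close>
  have "summable (\<lambda>n. A\<^sub>n n - A\<^sub>n (Suc n))"
    by (rule telescope_summable'[OF A_lim])
  then have sum: "summable (\<lambda>n. K * \<alpha> / A * (A\<^sub>n n - A\<^sub>n (Suc n)))"
    by (rule summable_mult)
  have "summable (\<lambda>n. prob {\<omega> \<in> space M. Z (Suc n) \<omega> \<noteq> Z n \<omega>})"
  proof (rule summable_comparison_test'[OF sum])
    fix n
    have a': "0 < 1 - a (Suc n)" using a[of "Suc n"] by simp
    have K0: "0 \<le> K" using K[of 0] dF_nonneg[of 0] by linarith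
    have "prob {\<omega> \<in> space M. Z (Suc n) \<omega> \<noteq> Z n \<omega>} \<le> K * (\<alpha> * (1 - a (Suc n)))"
      using a' alpha_gt_1 by (intro order_trans[OF prob_Z_changes mult_right_mono[OF K]]) simp
    also have "\<dots> = K * \<alpha> / A * (A * (1 - a (Suc n)))" using A by simp
    also have "\<dots> \<le> K * \<alpha> / A * (A\<^sub>n n * (1 - a (Suc n)))"
      using A K0 alpha_gt_1 a' A_le[of n] by (intro mult_left_mono mult_right_mono) auto
    also have "\<dots> = K * \<alpha> / A * (A\<^sub>n n - A\<^sub>n (Suc n))"
      by (simp add: gw_A_Suc algebra_simps)
    finally show "norm (prob {\<omega> \<in> space M. Z (Suc n) \<omega> \<noteq> Z n \<omega>}) \<le>
        K * \<alpha> / A * (A\<^sub>n n - A\<^sub>n (Suc n))" by simp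
  qed
  from borel_cantelli_AE1[OF _ _ this] show ?thesis
    by (auto simp: emeasure_eq_measure elim!: eventually_mono AE_mp intro!: AE_I2)
qed

text \<open>The eventual value of the path, with \<Delta> also as the default where there is none,
  which for \<open>A > 0\<close> happens with probability 0. At most one \<open>j\<close> qualifies;
  taking the least one makes measurability immediate.\<close>

definition Z_inf :: "'a \<Rightarrow> nat option" where
  "Z_inf \<omega> = (if \<exists>j. \<forall>\<^sub>F n in sequentially. Z n \<omega> = Some j
    then Some (LEAST j. \<forall>\<^sub>F n in sequentially. Z n \<omega> = Some j) else None)"

lemma measurable_Z_inf [measurable]: "Z_inf \<in> measurable M (count_space UNIV)"
proof -
  have [measurable]: "Measurable.pred M (\<lambda>\<omega>. \<forall>\<^sub>F n in sequentially. Z n \<omega> = Some j)" for j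
    unfolding eventually_sequentially by measurable
  have "(\<lambda>\<omega>. Some (LEAST j. \<forall>\<^sub>F n in sequentially. Z n \<omega> = Some j)) \<in> measurable M (count_space UNIV)"
    by (rule measurable_compose[where N = "count_space UNIV"]) simp_all
  then show ?thesis unfolding Z_inf_def[abs_def] by measurable
qed

lemma Z_inf_eqI:
  assumes "\<forall>\<^sub>F n in sequentially. Z n \<omega> = x"
  shows "Z_inf \<omega> = x"
proof -
  have uniq: "Some j = x" if "\<forall>\<^sub>F n in sequentially. Z n \<omega> = Some j" for j
    using eventually_happens[OF eventually_conj[OF that assms]] by auto
  show ?thesis
  proof (cases x)
    case None
    then show ?thesis using uniq by (auto simp: Z_inf_def)
  next
    case (Some k)
    then have ev: "\<forall>\<^sub>F n in sequentially. Z n \<omega> = Some k" using assms by simp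
    have "(LEAST j. \<forall>\<^sub>F n in sequentially. Z n \<omega> = Some j) = k"
    proof (rule Least_equality[where P = "\<lambda>j. \<forall>\<^sub>F n in sequentially. Z n \<omega> = Some j", OF ev])
      show "k \<le> j" if "\<forall>\<^sub>F n in sequentially. Z n \<omega> = Some j" for j
        using uniq[OF that] Some by simp
    qed
    moreover have "\<exists>j. \<forall>\<^sub>F n in sequentially. Z n \<omega> = Some j" using ev by blast
    ultimately show ?thesis by (simp only: Z_inf_def if_True Some)
  qed
qed

lemma AE_Z_eventually_Z_inf:
  assumes A: "0 < A"
  shows "AE \<omega> in M. \<forall>\<^sub>F n in sequentially. Z n \<omega> = Z_inf \<omega>"
  using AE_Z_eventually_const[OF A]
proof eventually_elim
  case (elim \<omega>)
  then obtain N where N: "Z (Suc n) \<omega> = Z n \<omega>" if "n \<ge> N" for n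
    by (auto simp: eventually_sequentially)
  have "Z n \<omega> = Z N \<omega>" if "n \<ge> N" for n
    using that by (induction n rule: dec_induct) (auto simp: N)
  then have ev: "\<forall>\<^sub>F n in sequentially. Z n \<omega> = Z N \<omega>"
    by (intro eventually_sequentiallyI)
  then show ?case by (simp add: Z_inf_eqI[OF ev])
qed

text \<open>Almost every path is eventually constant, so the weights converge; they are bounded by
  1, and dominated convergence transfers the limit of F_n(s) to the limit variable.\<close>

lemma integral_gw_weight_Z_inf:
  assumes A: "0 < A" and s: "0 \<le> s" "s \<le> 1"
  shows "(LINT \<omega>|M. gw_weight s (Z_inf \<omega>)) = r - (A * (r - s) powr (1 / \<alpha>) + C) powr \<alpha>"
proof (rule LIMSEQ_unique)
  show "(\<lambda>n. LINT \<omega>|M. gw_weight s (Z n \<omega>)) \<longlonglongrightarrow> (LINT \<omega>|M. gw_weight s (Z_inf \<omega>))"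
  proof (rule integral_dominated_convergence[where w = "\<lambda>_. 1"])
    show "AE \<omega> in M. (\<lambda>n. gw_weight s (Z n \<omega>)) \<longlonglongrightarrow> gw_weight s (Z_inf \<omega>)"
      using AE_Z_eventually_Z_inf[OF A]
      by eventually_elim (auto intro!: tendsto_eventually elim!: eventually_mono)
  qed (use gw_weight_bounds[OF s] in auto)
  show "(\<lambda>n. LINT \<omega>|M. gw_weight s (Z n \<omega>)) \<longlonglongrightarrow>
      r - (A * (r - s) powr (1 / \<alpha>) + C) powr \<alpha>"
    using F_lim[OF s] by (simp add: integral_gw_weight_Z s)
qed

lemma integral_power_Z_inf:
  assumes A: "0 < A" and s: "0 \<le> s" "s \<le> 1"
  shows "(LINT \<omega>:{\<omega> \<in> space M. Z_inf \<omega> \<noteq> None}|M. s ^ the (Z_inf \<omega>)) =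
    r - (A * (r - s) powr (1 / \<alpha>) + C) powr \<alpha>"
  unfolding set_lebesgue_integral_def integral_gw_weight_Z_inf[OF assms, symmetric]
  by (rule Bochner_Integration.integral_cong) (auto simp: indicator_def)

lemma prob_Z_inf_cemetery:
  assumes A: "0 < A"
  shows "prob {\<omega> \<in> space M. Z_inf \<omega> = None} = 1 - r + (A * (r - 1) powr (1 / \<alpha>) + C) powr \<alpha>"
proof -
  have "prob {\<omega> \<in> space M. Z_inf \<omega> \<noteq> None} = r - (A * (r - 1) powr (1 / \<alpha>) + C) powr \<alpha>"
    using integral_power_Z_inf[OF A, of 1] by (simp add: set_lebesgue_integral_def del: not_None_eq)
  then have "prob (space M - {\<omega> \<in> space M. Z_inf \<omega> \<noteq> None}) =
      1 - (r - (A * (r - 1) powr (1 / \<alpha>) + C) powr \<alpha>)"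
    by (subst prob_compl) (simp_all del: not_None_eq)
  also have "space M - {\<omega> \<in> space M. Z_inf \<omega> \<noteq> None} = {\<omega> \<in> space M. Z_inf \<omega> = None}" by auto
  finally show ?thesis by simp
qed

text \<open>Pulling \<open>(r - 1) powr (1 / \<alpha>)\<close> out of the base leaves, after raising
  to \<alpha> - 1, the factor \<open>(r - 1) powr (1 - 1 / \<alpha>)\<close>, which cancels the one
  in front.\<close>

lemma mean_limit_eq:
  "A * (r - 1) powr (1 / \<alpha> - 1) * (A * (r - 1) powr (1 / \<alpha>) + C) powr (\<alpha> - 1) =
    A * (A + C * (r - 1) powr (- 1 / \<alpha>)) powr (\<alpha> - 1)"
proof -
  have C: "0 \<le> C" by (rule LIMSEQ_le_const[OF C_lim]) (auto intro: C_nonneg)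
  have "(A * (r - 1) powr (1 / \<alpha>) + C) = (r - 1) powr (1 / \<alpha>) * (A + C * (r - 1) powr (- 1 / \<alpha>))"
    using r by (simp add: algebra_simps powr_minus)
  then have "(A * (r - 1) powr (1 / \<alpha>) + C) powr (\<alpha> - 1) =
      (r - 1) powr (1 - 1 / \<alpha>) * (A + C * (r - 1) powr (- 1 / \<alpha>)) powr (\<alpha> - 1)"
    using C A_nonneg alpha_gt_1 by (simp add: powr_mult powr_powr right_diff_distrib)
  moreover have "(r - 1) powr (1 / \<alpha> - 1) * (r - 1) powr (1 - 1 / \<alpha>) = 1"
    using r by (simp add: powr_add[symmetric])
  ultimately show ?thesis by (simp add: mult_ac)
qed

lemma mean_lim:
  "(\<lambda>n. LINT \<omega>:{\<omega> \<in> space M. tau_D Z \<omega> > enat n}|M. real (the (Z n \<omega>)))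
    \<longlonglongrightarrow> A * (A + C * (r - 1) powr (- 1 / \<alpha>)) powr (\<alpha> - 1)"
  unfolding integral_Z_alive using dF_lim unfolding mean_limit_eq .

end

theorem theorem8:
  fixes M :: "'w measure"
    and \<theta> r \<alpha> :: real
    and a c :: "nat \<Rightarrow> real"
    and p :: "nat \<Rightarrow> nat \<Rightarrow> real"
    and \<xi> :: "nat \<Rightarrow> nat \<Rightarrow> 'w \<Rightarrow> nat option"
    and Z :: "nat \<Rightarrow> 'w \<Rightarrow> nat option"
  assumes theta: "- 1 < \<theta>" "\<theta> < 0"
    and r: "r > 1"
    and alpha: "\<alpha> = - 1 / \<theta>"
    and a: "\<And>n. n \<ge> 1 \<Longrightarrow> 0 < a n \<and> a n < 1"
    and c: "\<And>n. n \<ge> 1 \<Longrightarrow> (1 - a n) * (r - 1) powr (- \<theta>) \<le> c n \<and>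
                            c n \<le> (1 - a n) * r powr (- \<theta>)"
    and Z: "gw_theta_process M \<theta> r a c p \<xi> Z"
  shows "\<alpha> > 1 \<and> (\<exists>A C. (gw_A a \<longlonglongrightarrow> A) \<and> 0 \<le> A \<and> A < 1 \<and>
    (gw_C a c \<longlonglongrightarrow> C) \<and>
    (1 - A) * (r - 1) powr (1 / \<alpha>) \<le> C \<and> C \<le> (1 - A) * r powr (1 / \<alpha>) \<and>
    absorption_prob M (tau_0 Z) = r - (A * r powr (1 / \<alpha>) + C) powr \<alpha> \<and>
    absorption_prob M (tau_D Z) = 1 - r + (A * (r - 1) powr (1 / \<alpha>) + C) powr \<alpha> \<and>
    (A = 0 \<longrightarrow>
      absorption_prob M (tau_0 Z) = 1 - absorption_prob M (tau_D Z) \<and>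
      absorption_prob M (tau_0 Z) = r - C powr \<alpha> \<and>
      r - C powr \<alpha> \<in> {0..1} \<and>
      absorption_prob M (tau Z) = 1 \<and>
      (\<lambda>n. inverse (gw_A a n) * measure M {\<omega> \<in> space M. tau Z \<omega> > enat n})
        \<longlonglongrightarrow> \<alpha> * C powr (\<alpha> - 1) * (r powr (1 / \<alpha>) - (r - 1) powr (1 / \<alpha>)) \<and>
      (\<lambda>n. cond_expect M (\<lambda>\<omega>. real (the (Z n \<omega>))) {\<omega> \<in> space M. tau Z \<omega> > enat n})
        \<longlonglongrightarrow> (r - 1) powr (1 / \<alpha> - 1) / (\<alpha> * (r powr (1 / \<alpha>) - (r - 1) powr (1 / \<alpha>))) \<and>
      (\<forall>s\<in>{0..1}.
        (\<lambda>n. cond_expect M (\<lambda>\<omega>. s ^ the (Z n \<omega>)) {\<omega> \<in> space M. tau Z \<omega> > enat n})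
          \<longlonglongrightarrow> (r powr (1 / \<alpha>) - (r - s) powr (1 / \<alpha>))
               / (r powr (1 / \<alpha>) - (r - 1) powr (1 / \<alpha>)))) \<and>
    (0 < A \<longrightarrow>
      0 \<le> absorption_prob M (tau Z) \<and> absorption_prob M (tau Z) < 1 \<and>
      (\<lambda>n. LINT \<omega>:{\<omega> \<in> space M. tau_D Z \<omega> > enat n}|M. real (the (Z n \<omega>)))
        \<longlonglongrightarrow> A * (A + C * (r - 1) powr (- 1 / \<alpha>)) powr (\<alpha> - 1) \<and>
      (\<exists>Zinf :: 'w \<Rightarrow> nat option. Zinf \<in> measurable M (count_space UNIV) \<and>
        (AE \<omega> in M. limitin (discrete_topology UNIV) (\<lambda>n. Z n \<omega>) (Zinf \<omega>) sequentially) \<and>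
        measure M {\<omega> \<in> space M. Zinf \<omega> = cemetery}
          = 1 - r + (A * (r - 1) powr (1 / \<alpha>) + C) powr \<alpha> \<and>
        (\<forall>s\<in>{0..1}.
          (LINT \<omega>:{\<omega> \<in> space M. Zinf \<omega> \<noteq> cemetery}|M. s ^ the (Zinf \<omega>))
            = r - (A * (r - s) powr (1 / \<alpha>) + C) powr \<alpha>))))"
proof -
  interpret gw_theta_process M \<theta> r a c p \<xi> Z by fact
  interpret gw_theta_regular M \<theta> r a c p \<xi> Z \<alpha>
    by unfold_locales (fact theta r alpha a c)+
  obtain A C where "gw_A a \<longlonglongrightarrow> A" "gw_C a c \<longlonglongrightarrow> C"
    using convergent_A convergent_C by (auto simp: convergent_def)
  then interpret gw_theta_limits M \<theta> r a c p \<xi> Z \<alpha> A C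
    by unfold_locales
  \<comment> \<open>For \<open>A = 0\<close> the interpolated base reduces to \<open>C\<close>; the
    choice \<open>s = 0\<close> is arbitrary.\<close>
  have "r - C powr \<alpha> \<in> {0..1}" if "A = 0"
    using interpolation_powr_bounds[OF A_nonneg less_imp_le[OF A_less_1] _ _ C_limit_bounds, of 0] that
    by simp
  moreover have "(\<lambda>n. inverse (gw_A a n) * prob {\<omega> \<in> space M. tau Z \<omega> > enat n})
      \<longlonglongrightarrow> \<alpha> * C powr (\<alpha> - 1) * (r powr (1 / \<alpha>) - (r - 1) powr (1 / \<alpha>))" if "A = 0"
    using F_diff_scaled_lim[OF that, of 1] by (simp add: prob_tau_gt divide_inverse mult.commute)
  moreover have "absorption_prob M (tau Z) < 1" if "0 < A"
  proof -
    \<comment> \<open>The gap between the two bases is a positive constant times \<open>A\<close>;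
      this is where positivity of \<open>A\<close> rules out certain absorption.\<close>
    have "A * (r - 1) powr (1 / \<alpha>) + C < A * r powr (1 / \<alpha>) + C"
      using powr_r_diff_pos that by simp
    then have "(A * (r - 1) powr (1 / \<alpha>) + C) powr \<alpha> < (A * r powr (1 / \<alpha>) + C) powr \<alpha>"
      using base_pos[of 1] alpha_gt_1 by (intro powr_less_mono2) auto
    then show ?thesis by (simp add: absorption_prob_tau)
  qed
  moreover have "AE \<omega> in M. limitin (discrete_topology UNIV) (\<lambda>n. Z n \<omega>) (Z_inf \<omega>) sequentially"
    if "0 < A"
    using AE_Z_eventually_Z_inf[OF that]
    \<comment> \<open>Singletons are open in the discrete topology, so eventual equality is exactly
      what convergence means here.\<close>
    by eventually_elim (auto simp: limitin_def elim!: eventually_mono)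
  moreover have "0 \<le> absorption_prob M (tau Z)"
    by (simp add: absorption_prob_def)
  ultimately show ?thesis
    by - (rule conjI[OF alpha_gt_1], rule exI[of _ A], rule exI[of _ C],
        intro conjI exI[of _ Z_inf] impI ballI A_lim C_lim A_nonneg A_less_1
        C_limit_bounds absorption_prob_tau_0 absorption_prob_tau_D cond_expect_Z_lim
        cond_expect_power_Z_lim prob_Z_inf_cemetery integral_power_Z_inf measurable_Z_inf mean_lim,
        simp_all add: absorption_prob_tau_0 absorption_prob_tau_D absorption_prob_tau)
qed

end
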